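(* The algebra $Sym^{(\ell)}$ of ordinary (commutative) multi-symmetric functions admits an internal product induced by the internal product $*$ of $\mathbf{Sym}^{(\ell)}$. Namely, denoting by $\underline{F}\in Sym^{(\ell)}$ the commutative image of $F\in\mathbf{Sym}^{(\ell)}$, for all $F,F',G,G'\in\mathbf{Sym}^{(\ell)}$ one has $$\underline{F*G}=\underline{F'*G'}\quad\text{as soon as}\quad\underline{F}=\underline{F'}\ \text{ and }\ \underline{G}=\underline{G'}.$$
   Context: The ground ring is a field of characteristic $0$. The color set $C$ (with $\ell$ elements, $\ell=\infty$ allowed) is a commutative additive semigroup such that every $\gamma\in C$ has only finitely many decompositions $\gamma=\alpha+\beta$ with $\alpha,\beta\in C$. Vectors below are finitely supported vectors $\mathbf{n}=(n_c)_{c\in C}$ of nonnegative integers. $\mathbf{Sym}^{(\ell)}$ is the free associative algebra on symbols $S_{\mathbf{n}}$, $\mathbf{n}\ne 0$ (with $S_{\mathbf{0}}=1$). It is realized on noncommuting variables $a_i^{(c)}$ ($i\ge 1$, $c\in C$) by $$\sum_{\mathbf{n}}S_{\mathbf{n}}\,\mathbf{x}^{\mathbf{n}}=\prod_{i\ge 1}^{\rightarrow}\Big(1-\sum_{c\in C}x^{(c)}a_i^{(c)}\Big)^{-1},$$ with $x^{(c)}$ commuting variables and $\mathbf{x}^{\mathbf{n}}=\prod_c(x^{(c)})^{n_c}$. Its linear basis is $S^{\mathbf{I}}=S_{\mathbf{i}_1}\cdots S_{\mathbf{i}_m}$, where $\mathbf{I}=(\mathbf{i}_1,\ldots,\mathbf{i}_m)$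 runs over vector compositions (finite sequences of nonzero vectors). The commutative image $F\mapsto\underline{F}$ is the algebra morphism obtained by letting the variables $a_i^{(c)}$ commute; its image is the algebra $Sym^{(\ell)}$ of multi-symmetric functions, i.e. the invariants in infinitely many variables of the diagonal action $\sigma(a_i^{(c)})=a_{\sigma(i)}^{(c)}$. $QSym^{(\ell)}$ is the algebra with basis $M_{\mathbf{I}}(\mathbb{X})=\sum_{j_1<\cdots<j_m}\mathbf{x}_{j_1}^{\mathbf{i}_1}\cdots\mathbf{x}_{j_m}^{\mathbf{i}_m}$, with $\mathbf{x}_j^{\mathbf{i}}=\prod_c(x_j^{(c)})^{i_c}$, where $\mathbb{X}=\{x_j^{(c)}\}$ are commuting variables with $j$ running over a totally ordered set. For two alphabets $\mathbb{X},\mathbb{Y}$ let $\mathbb{X}\times_C\mathbb{Y}$ have variables $t_{rs}^{(\gamma)}=\sum_{\alpha+\beta=\gamma}x_r^{(\alpha)}y_s^{(\beta)}$, with pairs $(r,s)$ ordered lexicographically, and let $\delta(F)=F(\mathbb{X}\times_C\mathbb{Y})\in QSym^{(\ell)}\otimes QSym^{(\ell)}$ (identifying $f(\mathbb{X})g(\mathbb{Y})$ with $f\otimes g$). The internal product $*$ on $\mathbf{Sym}^{(\ell)}$ is dual to $\delta$: the coefficient of $S^{\mathbf{K}}$ in $S^{\mathbf{I}}*S^{\mathbf{J}}$ is the coefficient of $M_{\mathbf{I}}\otimes M_{\mathbf{J}}$ in $\delta(M_{\mathbf{K}})$. *)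

theory Defs
  imports Complex_Main "HOL-Library.Multiset" "HOL-Library.Poly_Mapping" "HOL-Library.Product_Plus"
begin

section \<open>Finite decompositions and free monoids\<close>

text \<open>The color semigroup is a type of sort \<open>{ab_semigroup_add, finite_decomp}\<close>; it may be infinite.
  The same condition on a monoid of monomials makes the product of arbitrary formal series
  well defined.\<close>

class finite_decomp = plus +
  assumes finite_decomp: "finite {(a, b). a + b = c}"

text \<open>The free monoid, written additively so that \<^typ>\<open>'m \<Rightarrow>\<^sub>0 'k\<close> is its monoid algebra.\<close>

datatype 'a fmon = Word (letters: "'a list")

instantiation fmon :: (type) monoid_add
begin

definition zero_fmon :: "'a fmon" where
  "zero_fmon = Word []"

definition plus_fmon :: "'a fmon \<Rightarrow> 'a fmon \<Rightarrow> 'a fmon" where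
  "plus_fmon u v = Word (letters u @ letters v)"

instance
  by standard (simp_all add: zero_fmon_def plus_fmon_def)

end

instance fmon :: (type) finite_decomp
proof
  fix w :: "'a fmon"
  have "{(u, v). u + v = w} \<subseteq>
      (\<lambda>n. (Word (take n (letters w)), Word (drop n (letters w)))) ` {..length (letters w)}"
  proof safe
    fix u v :: "'a fmon"
    show "(u, v) \<in> (\<lambda>n. (Word (take n (letters (u + v))), Word (drop n (letters (u + v))))) `
        {..length (letters (u + v))}"
      by (rule image_eqI[where x = "length (letters u)"]) (simp_all add: plus_fmon_def)
  qed
  then show "finite {(u, v). u + v = w}"
    by (rule finite_subset) simp
qed

instance multiset :: (type) finite_decomp
proof
  fix m :: "'a multiset"
  obtain w where w: "mset w = m"
    using ex_mset by blast
  have fin: "finite {xs. set xs \<subseteq> set w \<and> length xs \<le> length w}"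
    by (rule finite_lists_length_le) simp
  have "{(a, b). a + b = m} \<subseteq> (mset ` {xs. set xs \<subseteq> set w \<and> length xs \<le> length w}) \<times>
      (mset ` {xs. set xs \<subseteq> set w \<and> length xs \<le> length w})"
  proof safe
    fix a b :: "'a multiset"
    assume ab: "m = a + b"
    obtain xs ys where xs: "mset xs = a" and ys: "mset ys = b"
      using ex_mset by metis
    have eq: "mset w = mset (xs @ ys)"
      using w xs ys ab by simp
    have "length w = length xs + length ys" "set w = set xs \<union> set ys"
      using mset_eq_length[OF eq] mset_eq_setD[OF eq] by simp_all
    then show "a \<in> mset ` {xs. set xs \<subseteq> set w \<and> length xs \<le> length w}"
      and "b \<in> mset ` {xs. set xs \<subseteq> set w \<and> length xs \<le> length w}"
      using xs ys by auto
  qed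
  then show "finite {(a, b). a + b = m}"
    by (rule finite_subset) (use fin in simp)
qed

instance prod :: (finite_decomp, finite_decomp) finite_decomp
proof
  fix m :: "'a \<times> 'b"
  have "{(p, q). p + q = m} \<subseteq> (\<lambda>((a, b), (c, d)). ((a, c), (b, d))) `
      ({(a, b). a + b = fst m} \<times> {(c, d). c + d = snd m})"
    proof safe
    fix a c :: 'a and b d :: 'b
    show "((a, b), (c, d)) \<in> (\<lambda>((a, b), (c, d)). ((a, c), (b, d))) `
        ({(x, y). x + y = fst ((a, b) + (c, d))} \<times> {(x, y). x + y = snd ((a, b) + (c, d))})"
      by (rule image_eqI[where x = "((a, c), (b, d))"]) simp_all
  qed
  then show "finite {(p, q). p + q = m}"
    by (rule finite_subset) (intro finite_imageI finite_cartesian_product finite_decomp)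
qed


section \<open>Formal series over a monoid\<close>

text \<open>All functions from the monoid \<^typ>\<open>'m\<close> of monomials to the coefficients: formal power series
  in commuting variables \<^typ>\<open>'v\<close> for monomials \<^typ>\<open>'v multiset\<close>, in noncommuting variables for
  monomials \<^typ>\<open>'v fmon\<close>. Elements of a product monoid are monomials in two sets of
  variables which commute with each other.\<close>

datatype ('m, 'k) fseries = FSeries (scoeff: "'m \<Rightarrow> 'k")

lemma fseries_eqI: "(\<And>m. scoeff f m = scoeff g m) \<Longrightarrow> f = g"
  by (rule fseries.expand) auto

instantiation fseries :: ("{monoid_add, finite_decomp}", ring_1) ring_1
begin

definition zero_fseries :: "('a, 'b) fseries" where
  "zero_fseries = FSeries (\<lambda>_. 0)"

definition one_fseries :: "('a, 'b) fseries" where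
  "one_fseries = FSeries (\<lambda>m. if m = 0 then 1 else 0)"

definition plus_fseries :: "('a, 'b) fseries \<Rightarrow> ('a, 'b) fseries \<Rightarrow> ('a, 'b) fseries" where
  "plus_fseries f g = FSeries (\<lambda>m. scoeff f m + scoeff g m)"

definition minus_fseries :: "('a, 'b) fseries \<Rightarrow> ('a, 'b) fseries \<Rightarrow> ('a, 'b) fseries" where
  "minus_fseries f g = FSeries (\<lambda>m. scoeff f m - scoeff g m)"

definition uminus_fseries :: "('a, 'b) fseries \<Rightarrow> ('a, 'b) fseries" where
  "uminus_fseries f = FSeries (\<lambda>m. - scoeff f m)"

definition times_fseries :: "('a, 'b) fseries \<Rightarrow> ('a, 'b) fseries \<Rightarrow> ('a, 'b) fseries" where
  "times_fseries f g = FSeries (\<lambda>m. \<Sum>(a, b) | a + b = m. scoeff f a * scoeff g b)"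

instance
proof
  fix f g h :: "('a, 'b) fseries"
  have fin: "finite {(a, b). a + b = m}" for m :: 'a
    by (rule finite_decomp)
  show "f * g * h = f * (g * h)"
  proof (rule fseries_eqI)
    fix m
    have "scoeff (f * g * h) m =
        (\<Sum>p\<in>{(a, b). a + b = m}. \<Sum>q\<in>{(a, b). a + b = fst p}.
          scoeff f (fst q) * scoeff g (snd q) * scoeff h (snd p))"
      by (simp add: times_fseries_def sum_distrib_right split_beta)
    also have "\<dots> = (\<Sum>(p, q)\<in>(SIGMA p:{(a, b). a + b = m}. {(a, b). a + b = fst p}).
          scoeff f (fst q) * scoeff g (snd q) * scoeff h (snd p))"
      by (rule sum.Sigma) (use fin in auto)
    also have "\<dots> = (\<Sum>(p, q)\<in>(SIGMA p:{(a, b). a + b = m}. {(a, b). a + b = snd p}).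
          scoeff f (fst p) * scoeff g (fst q) * scoeff h (snd q))"
      by (rule sum.reindex_bij_witness[
            where i = "\<lambda>(p, q). ((fst p + fst q, snd q), (fst p, fst q))"
              and j = "\<lambda>(p, q). ((fst q, snd q + snd p), (snd q, snd p))"])
        (auto simp: add.assoc)
    also have "\<dots> = (\<Sum>p\<in>{(a, b). a + b = m}. \<Sum>q\<in>{(a, b). a + b = snd p}.
          scoeff f (fst p) * scoeff g (fst q) * scoeff h (snd q))"
      by (rule sum.Sigma[symmetric]) (use fin in auto)
    also have "\<dots> = scoeff (f * (g * h)) m"
      by (simp add: times_fseries_def sum_distrib_left split_beta mult.assoc)
    finally show "scoeff (f * g * h) m = scoeff (f * (g * h)) m" .
  qed
  show "1 * f = f"
  proof (rule fseries_eqI)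
    fix m
    have "scoeff (1 * f) m = (\<Sum>p\<in>{(a, b). a + b = m}. if fst p = 0 then scoeff f (snd p) else 0)"
      by (simp add: times_fseries_def one_fseries_def split_beta if_distrib[where f = "\<lambda>x. x * _"] cong: if_cong)
    also have "\<dots> = (\<Sum>p\<in>{(0 :: 'a, m)}. scoeff f (snd p))"
      using fin[of m] by (intro sum.mono_neutral_cong_right) auto
    finally show "scoeff (1 * f) m = scoeff f m" by simp
  qed
  show "f * 1 = f"
  proof (rule fseries_eqI)
    fix m
    have "scoeff (f * 1) m = (\<Sum>p\<in>{(a, b). a + b = m}. if snd p = 0 then scoeff f (fst p) else 0)"
      by (simp add: times_fseries_def one_fseries_def split_beta if_distrib[where f = "\<lambda>x. _ * x"] cong: if_cong)
    also have "\<dots> = (\<Sum>p\<in>{(m, 0 :: 'a)}. scoeff f (fst p))"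
      using fin[of m] by (intro sum.mono_neutral_cong_right) auto
    finally show "scoeff (f * 1) m = scoeff f m" by simp
  qed
  show "(f + g) * h = f * h + g * h" "f * (g + h) = f * g + f * h"
    by (simp_all add: times_fseries_def plus_fseries_def split_beta distrib_right distrib_left sum.distrib)
  show "(0 :: ('a, 'b) fseries) \<noteq> 1"
    by (auto simp: zero_fseries_def one_fseries_def fun_eq_iff)
qed (simp_all add: plus_fseries_def minus_fseries_def uminus_fseries_def zero_fseries_def add_ac)

end

instance fseries :: ("{comm_monoid_add, finite_decomp}", comm_ring_1) comm_ring_1
proof
  fix f g :: "('a, 'b) fseries"
  show "f * g = g * f"
  proof (rule fseries_eqI)
    fix m
    have "(\<Sum>(a, b) | a + b = m. scoeff f a * scoeff g b) =
        (\<Sum>(a, b) | a + b = m. scoeff g a * scoeff f b)"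
      by (rule sum.reindex_bij_witness[where i = prod.swap and j = prod.swap])
        (auto simp: ac_simps)
    then show "scoeff (f * g) m = scoeff (g * f) m"
      by (simp add: times_fseries_def)
  qed
qed (simp_all add: distrib_right)

definition smonom :: "'m \<Rightarrow> ('m, 'k::zero_neq_one) fseries" where
  "smonom m = FSeries (\<lambda>m'. if m' = m then 1 else 0)"

definition sscale :: "'k \<Rightarrow> ('m, 'k::times) fseries \<Rightarrow> ('m, 'k) fseries" where
  "sscale a f = FSeries (\<lambda>m. a * scoeff f m)"

text \<open>Formal sum of a family that is locally finite, i.e.\ each monomial occurs in only finitely many
  members.\<close>

definition fsum :: "'i set \<Rightarrow> ('i \<Rightarrow> ('m, 'k::comm_monoid_add) fseries) \<Rightarrow> ('m, 'k) fseries" where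
  "fsum A f = FSeries (\<lambda>m. \<Sum>i | i \<in> A \<and> scoeff (f i) m \<noteq> 0. scoeff (f i) m)"

text \<open>The infinite ordered product \<open>f 0 * f 1 * f 2 * \<dots>\<close>: coefficientwise the eventual value of the
  partial products.\<close>

definition ordered_prod :: "(nat \<Rightarrow> ('m::{monoid_add, finite_decomp}, 'k::ring_1) fseries) \<Rightarrow> ('m, 'k) fseries" where
  "ordered_prod f = FSeries (\<lambda>m. THE a. \<forall>\<^sub>F N in sequentially. scoeff (prod_list (map f [0..<N])) m = a)"

definition ring_inv :: "'r::ring_1 \<Rightarrow> 'r" where
  "ring_inv u = (THE v. u * v = 1 \<and> v * u = 1)"


section \<open>Vector compositions and the algebra of noncommutative multi-symmetric functions\<close>

text \<open>Finitely supported vectors of nonnegative integers indexed by colors are multisets of colors;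
  the component \<open>n\<^sub>c\<close> is \<^term>\<open>count n c\<close>.\<close>

typedef 'c nzvec = "{n :: 'c multiset. n \<noteq> {#}}"
  morphisms vec_of Abs_nzvec
  by (rule exI[of _ "{#undefined#}"]) simp

type_synonym 'c vcomp = "'c nzvec fmon"

text \<open>The free associative algebra on the symbols \<open>S\<^sub>n\<close>: the basis element indexed by \<open>I\<close> is
  \<open>S\<^sup>I = Poly_Mapping.single I 1\<close>, and \<open>*\<close> on this type is the concatenation product.\<close>

type_synonym ('c, 'k) ncsym = "'c vcomp \<Rightarrow>\<^sub>0 'k"

text \<open>The variable \<open>a\<^sub>i\<^sup>(\<^sup>c\<^sup>)\<close> is the letter \<open>(i, c)\<close>; positions \<open>i\<close> are numbered from \<open>0\<close> instead of \<open>1\<close>.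
  A monomial \<open>(n, w)\<close> stands for \<open>x\<^sup>n w\<close>, where the \<open>x\<^sup>(\<^sup>c\<^sup>)\<close> commute with everything.\<close>

definition S_gen :: "('c multiset \<times> (nat \<times> 'c) fmon, 'k::field_char_0) fseries" where
  "S_gen = ordered_prod (\<lambda>i. ring_inv (1 - fsum UNIV (\<lambda>c. smonom ({#c#}, Word [(i, c)]))))"

definition S_real :: "'c multiset \<Rightarrow> ((nat \<times> 'c) fmon, 'k::field_char_0) fseries" where
  "S_real n = FSeries (\<lambda>w. scoeff S_gen (n, w))"

definition realize :: "('c, 'k::field_char_0) ncsym \<Rightarrow> ((nat \<times> 'c) fmon, 'k) fseries" where
  "realize F = (\<Sum>I\<in>Poly_Mapping.keys F.
     sscale (Poly_Mapping.lookup F I) (prod_list (map (\<lambda>n. S_real (vec_of n)) (letters I))))"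

definition abelianize :: "('v fmon, 'k::comm_monoid_add) fseries \<Rightarrow> ('v multiset, 'k) fseries" where
  "abelianize f = FSeries (\<lambda>m. \<Sum>w | mset (letters w) = m. scoeff f w)"

definition comm_image :: "('c, 'k::field_char_0) ncsym \<Rightarrow> ((nat \<times> 'c) multiset, 'k) fseries" where
  "comm_image F = abelianize (realize F)"

text \<open>The algebra of commutative multi-symmetric functions, as the image of the commutative image map.\<close>

definition MSym :: "((nat \<times> 'c) multiset, 'k::field_char_0) fseries set" where
  "MSym = range comm_image"


section \<open>Multi-quasi-symmetric functions and the internal product\<close>

text \<open>\<open>M\<^sub>I\<close> evaluated at a family \<open>z j c\<close> of ring elements indexed by colors and by positions \<open>j\<close> that
  are strictly ordered by \<open>lt\<close>.\<close>

definition M_eval :: "('j \<Rightarrow> 'j \<Rightarrow> bool) \<Rightarrow>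
    ('j \<Rightarrow> 'c \<Rightarrow> ('m::{comm_monoid_add, finite_decomp}, 'k::comm_ring_1) fseries) \<Rightarrow>
    'c vcomp \<Rightarrow> ('m, 'k) fseries" where
  "M_eval lt z I = fsum {js. length js = length (letters I) \<and> sorted_wrt lt js}
     (\<lambda>js. \<Prod>l<length (letters I). \<Prod>c\<in>set_mset (vec_of (letters I ! l)).
        z (js ! l) c ^ count (vec_of (letters I ! l)) c)"

text \<open>Series in two alphabets \<open>X\<close> and \<open>Y\<close>, each with positions in \<^typ>\<open>nat\<close>.\<close>

type_synonym ('c, 'k) biseries = "((nat \<times> 'c) multiset \<times> (nat \<times> 'c) multiset, 'k) fseries"

definition varX :: "nat \<Rightarrow> 'c \<Rightarrow> ('c, 'k::field_char_0) biseries" where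
  "varX r c = smonom ({#(r, c)#}, {#})"

definition varY :: "nat \<Rightarrow> 'c \<Rightarrow> ('c, 'k::field_char_0) biseries" where
  "varY s c = smonom ({#}, {#(s, c)#})"

definition varXY :: "nat \<times> nat \<Rightarrow> 'c::{ab_semigroup_add, finite_decomp} \<Rightarrow> ('c, 'k::field_char_0) biseries" where
  "varXY p c = (\<Sum>(a, b) | a + b = c. varX (fst p) a * varY (snd p) b)"

definition lex_less :: "nat \<times> nat \<Rightarrow> nat \<times> nat \<Rightarrow> bool" where
  "lex_less p q \<longleftrightarrow> fst p < fst q \<or> fst p = fst q \<and> snd p < snd q"

definition delta_M :: "'c::{ab_semigroup_add, finite_decomp} vcomp \<Rightarrow> ('c, 'k::field_char_0) biseries" where
  "delta_M K = M_eval lex_less varXY K"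

definition M_tensor :: "'c vcomp \<Rightarrow> 'c vcomp \<Rightarrow> ('c, 'k::field_char_0) biseries" where
  "M_tensor I J = M_eval (<) varX I * M_eval (<) varY J"

interpretation biseries: vector_space "sscale :: 'k::field_char_0 \<Rightarrow> ('c, 'k) biseries \<Rightarrow> _"
  by standard
    (simp_all add: sscale_def plus_fseries_def distrib_left distrib_right mult.assoc)

text \<open>Coefficient of \<open>M\<^sub>I \<otimes> M\<^sub>J\<close> in \<open>\<delta>(M\<^sub>K)\<close>, where \<open>f \<otimes> g\<close> is identified with \<open>f(X) g(Y)\<close>, so that
  \<open>QSym \<otimes> QSym\<close> is the span of the products \<open>M\<^sub>I(X) M\<^sub>J(Y)\<close>.\<close>

definition delta_coeff :: "'c::{ab_semigroup_add, finite_decomp} vcomp \<Rightarrow> 'c vcomp \<Rightarrow> 'c vcomp \<Rightarrow> 'k::field_char_0" where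
  "delta_coeff K I J =
     biseries.representation (range (\<lambda>(I', J'). M_tensor I' J')) (delta_M K) (M_tensor I J)"

text \<open>For fixed \<open>I\<close> and \<open>J\<close> only finitely many \<open>K\<close> contribute (lemma \<open>finite_delta_coeff\<close> below):
  \<open>M\<^sub>I \<otimes> M\<^sub>J\<close> is the only basis element that contains the monomial given by \<open>leading I\<close> and \<open>leading J\<close>,
  and this monomial bounds the size and the colors of \<open>K\<close>.\<close>

lemma smonom_mult: "smonom a * smonom b = (smonom (a + b) :: ('m::{monoid_add, finite_decomp}, 'k::comm_ring_1) fseries)"
proof (rule fseries_eqI)
  fix m :: 'm
  have "scoeff (smonom a * smonom b :: ('m, 'k) fseries) m =
      (\<Sum>p\<in>{(x, y). x + y = m}. if p = (a, b) then 1 else 0)"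
    unfolding times_fseries_def smonom_def by (auto intro!: sum.cong)
  also have "\<dots> = scoeff (smonom (a + b) :: ('m, 'k) fseries) m"
    using finite_decomp[of m] by (auto simp: smonom_def)
  finally show "scoeff (smonom a * smonom b :: ('m, 'k) fseries) m = scoeff (smonom (a + b)) m" .
qed

lemma smonom_zero: "smonom 0 = (1 :: ('m::{monoid_add, finite_decomp}, 'k::comm_ring_1) fseries)"
  by (simp add: smonom_def one_fseries_def)

lemma prod_smonom: "(\<Prod>i\<in>A. smonom (f i)) = (smonom (\<Sum>i\<in>A. f i) ::
    ('m::{comm_monoid_add, finite_decomp}, 'k::comm_ring_1) fseries)"
  by (induction A rule: infinite_finite_induct) (simp_all add: smonom_zero smonom_mult)

lemma prod_mset_smonom: "(\<Prod>i\<in>#A. smonom (f i)) = (smonom (\<Sum>i\<in>#A. f i) ::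
    ('m::{comm_monoid_add, finite_decomp}, 'k::comm_ring_1) fseries)"
  by (induction A) (simp_all add: smonom_zero smonom_mult)

lemma prod_power_count: "(\<Prod>c\<in>set_mset n. z c ^ count n c) = (\<Prod>c\<in>#n. z c :: 'a::comm_monoid_mult)"
  by (simp add: image_prod_mset_multiplicity)

definition place :: "nat list \<Rightarrow> 'c vcomp \<Rightarrow> (nat \<times> 'c) multiset" where
  "place js I = (\<Sum>l<length (letters I). image_mset (Pair (js ! l)) (vec_of (letters I ! l)))"

abbreviation leading :: "'c vcomp \<Rightarrow> (nat \<times> 'c) multiset" where
  "leading I \<equiv> place [0..<length (letters I)] I"

lemma vec_of_ne: "vec_of n \<noteq> {#}"
  using vec_of[of n] by simp

lemma fst_place:
  assumes "length js = length (letters I)"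
  shows "fst ` set_mset (place js I) = set js"
proof -
  have "fst ` set_mset (place js I) = (\<Union>l<length (letters I). fst ` set_mset (image_mset (Pair (js ! l)) (vec_of (letters I ! l))))"
    by (simp add: place_def set_mset_sum image_UN)
  also have "\<dots> = (\<Union>l<length (letters I). {js ! l})"
    using vec_of_ne by (intro SUP_cong) (simp_all add: image_image image_constant_conv)
  also have "\<dots> = set js"
    using assms by (auto simp: set_conv_nth)
  finally show ?thesis .
qed

lemma place_inject:
  assumes "length js = length (letters I)" "distinct js" "length (letters I) = length (letters I')"
    and eq: "place js I = place js I'"
  shows "I = I'"
proof -
  have *: "count (vec_of (letters I ! l)) c = count (place js I) (js ! l, c)"
    if I: "length js = length (letters I)" and l: "l < length js" for I :: "'a vcomp" and l c
  proof -
    have cnt: "count (image_mset (Pair j) n) (j', c) = (if j = j' then count n c else 0)"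
      for j j' :: nat and n :: "'a multiset"
      by (induction n) auto
    have "count (place js I) (js ! l, c) =
        (\<Sum>k<length js. if k = l then count (vec_of (letters I ! l)) c else 0)"
      unfolding place_def I[symmetric] count_sum cnt
      using l assms(2) by (intro sum.cong) (auto simp: nth_eq_iff_index_eq)
    then show ?thesis
      using l by simp
  qed
  have "letters I = letters I'"
  proof (rule nth_equalityI)
    fix l assume "l < length (letters I)"
    then have "vec_of (letters I ! l) = vec_of (letters I' ! l)"
      using *[of I l] *[of I' l] assms by (intro multiset_eqI) simp
    then show "letters I ! l = letters I' ! l"
      by (simp add: vec_of_inject)
  qed (use assms in simp)
  then show ?thesis
    by (simp add: fmon.expand)
qed

lemma place_eq_leading_iff:
  assumes js: "length js = length (letters I')" "sorted_wrt (<) js"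
  shows "place js I' = leading I \<longleftrightarrow> I' = I \<and> js = [0..<length (letters I)]"
proof
  assume eq: "place js I' = leading I"
  then have "set js = set [0..<length (letters I)]"
    using fst_place[OF js(1)] fst_place[of "[0..<length (letters I)]" I] by simp
  then have j: "js = [0..<length (letters I)]"
    using js(2) by (intro sorted_distinct_set_unique) (simp_all add: strict_sorted_iff)
  have len: "length (letters I') = length (letters I)"
    using js(1) j by (metis length_upt minus_nat.diff_0)
  have "place js I' = place js I"
    using eq j by (simp only:)
  then have "I' = I"
    using place_inject[of js I' I] js len by (simp add: strict_sorted_iff)
  with j show "I' = I \<and> js = [0..<length (letters I)]"
    by blast
qed auto

lemma sum_mset_pair: "(\<Sum>x\<in>#A. (f x, g x)) = ((\<Sum>x\<in>#A. f x), (\<Sum>x\<in>#A. g x))"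
  by (induction A) (simp_all add: zero_prod_def)

lemma sum_pair: "(\<Sum>x\<in>A. (f x, g x)) = ((\<Sum>x\<in>A. f x), (\<Sum>x\<in>A. g x))"
  by (induction A rule: infinite_finite_induct) (simp_all add: zero_prod_def)

lemma M_eval_var:
  "M_eval (<) varX I = fsum {js. length js = length (letters I) \<and> sorted_wrt (<) js}
     (\<lambda>js. smonom (place js I, {#}) :: ('c, 'k::field_char_0) biseries)" (is ?X)
  "M_eval (<) varY I = fsum {js. length js = length (letters I) \<and> sorted_wrt (<) js}
     (\<lambda>js. smonom ({#}, place js I) :: ('c, 'k::field_char_0) biseries)" (is ?Y)
proof -
  show ?X
    by (simp add: M_eval_def prod_power_count varX_def prod_mset_smonom prod_smonom place_def
        sum_mset_pair sum_pair)
  show ?Y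
    by (simp add: M_eval_def prod_power_count varY_def prod_mset_smonom prod_smonom place_def
        sum_mset_pair sum_pair)
qed

lemma scoeff_M_eval_eq_0:
  "snd m \<noteq> {#} \<Longrightarrow> scoeff (M_eval (<) varX I :: ('c, 'k::field_char_0) biseries) m = 0"
  "fst m \<noteq> {#} \<Longrightarrow> scoeff (M_eval (<) varY I :: ('c, 'k::field_char_0) biseries) m = 0"
  proof -
  assume "snd m \<noteq> {#}"
  then have "m \<noteq> (place js I, {#})" for js
    by auto
  then show "scoeff (M_eval (<) varX I :: ('c, 'k) biseries) m = 0"
    by (simp add: M_eval_var fsum_def smonom_def)
next
  assume "fst m \<noteq> {#}"
  then have "m \<noteq> ({#}, place js I)" for js
    by auto
  then show "scoeff (M_eval (<) varY I :: ('c, 'k) biseries) m = 0"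
    by (simp add: M_eval_var fsum_def smonom_def)
qed

lemma scoeff_M_eval_leading:
  "scoeff (M_eval (<) varX I' :: ('c, 'k::field_char_0) biseries) (leading I, {#}) = (if I' = I then 1 else 0)" (is ?X)
  "scoeff (M_eval (<) varY I' :: ('c, 'k::field_char_0) biseries) ({#}, leading I) = (if I' = I then 1 else 0)" (is ?Y)
proof -
  have *: "{js. (length js = length (letters I') \<and> sorted_wrt (<) js) \<and> place js I' = leading I} =
      (if I' = I then {[0..<length (letters I)]} else {})"
    using place_eq_leading_iff[of _ I' I] by auto
  have "scoeff (M_eval (<) varX I' :: ('c, 'k) biseries) (leading I, {#}) =
     (\<Sum>js\<in>{js. (length js = length (letters I') \<and> sorted_wrt (<) js) \<and> place js I' = leading I}. 1)"
    unfolding M_eval_var fsum_def smonom_def fseries.sel by (rule sum.cong) auto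
  then show ?X
    unfolding * by simp
  have "scoeff (M_eval (<) varY I' :: ('c, 'k) biseries) ({#}, leading I) =
     (\<Sum>js\<in>{js. (length js = length (letters I') \<and> sorted_wrt (<) js) \<and> place js I' = leading I}. 1)"
    unfolding M_eval_var fsum_def smonom_def fseries.sel by (rule sum.cong) auto
  then show ?Y
    unfolding * by simp
qed

lemma scoeff_M_tensor_leading:
  "scoeff (M_tensor I' J' :: ('c, 'k::field_char_0) biseries) (leading I, leading J) =
    (if I' = I \<and> J' = J then 1 else 0)"
proof -
  let ?X = "scoeff (M_eval (<) varX I' :: ('c, 'k) biseries)"
  let ?Y = "scoeff (M_eval (<) varY J' :: ('c, 'k) biseries)"
  let ?s = "{(a, b). a + b = (leading I, leading J)}"
  have "scoeff (M_tensor I' J' :: ('c, 'k) biseries) (leading I, leading J) = (\<Sum>(a, b)\<in>?s. ?X a * ?Y b)"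
    by (simp add: M_tensor_def times_fseries_def)
  also have "\<dots> = (\<Sum>(a, b)\<in>{((leading I, {#}), ({#}, leading J))}. ?X a * ?Y b)"
  proof (rule sum.mono_neutral_right)
    show "finite ?s"
      by (rule finite_decomp)
    show "\<forall>p\<in>?s - {((leading I, {#}), ({#}, leading J))}. (case p of (a, b) \<Rightarrow> ?X a * ?Y b) = 0"
    proof (intro ballI, rule ccontr)
      fix p assume p: "p \<in> ?s - {((leading I, {#}), ({#}, leading J))}"
        and ne: "(case p of (a, b) \<Rightarrow> ?X a * ?Y b) \<noteq> 0"
      obtain a b c d where abcd: "p = ((a, b), (c, d))"
        by (metis prod.exhaust)
      have "b = {#}" "c = {#}"
        using ne scoeff_M_eval_eq_0(1)[of "(a, b)" I', where 'k = 'k]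
          scoeff_M_eval_eq_0(2)[of "(c, d)" J', where 'k = 'k] by (auto simp: abcd)
      with p show False
        by (auto simp: abcd)
    qed
    show "{((leading I, {#}), ({#}, leading J))} \<subseteq> ?s"
      by simp
  qed
  finally show ?thesis
    by (simp add: scoeff_M_eval_leading)
qed

lemma scoeff_sum: "scoeff (\<Sum>i\<in>A. f i) m = (\<Sum>i\<in>A. scoeff (f i) m)"
  by (induction A rule: infinite_finite_induct) (simp_all add: zero_fseries_def plus_fseries_def)

lemma delta_coeff_nonzero_imp:
  assumes "delta_coeff K I J \<noteq> (0 :: 'k::field_char_0)"
  shows "scoeff (delta_M K :: ('c::{ab_semigroup_add, finite_decomp}, 'k) biseries) (leading I, leading J) \<noteq> 0"
proof -
  define B where "B = (range (\<lambda>(I', J'). M_tensor I' J') :: ('c, 'k) biseries set)"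
  define r where "r = biseries.representation B (delta_M K)"
  have r: "r (M_tensor I J) \<noteq> 0"
    using assms by (simp add: delta_coeff_def r_def B_def)
  then have ind: "biseries.independent B" and sp: "delta_M K \<in> biseries.span B"
    by (auto simp: r_def biseries.representation_def split: if_splits)
  have fin: "finite {b. r b \<noteq> 0}"
    unfolding r_def by (rule biseries.finite_representation)
  have "scoeff (delta_M K :: ('c, 'k) biseries) (leading I, leading J) =
      (\<Sum>b | r b \<noteq> 0. r b * scoeff b (leading I, leading J))"
    by (subst biseries.sum_nonzero_representation_eq[OF ind sp, folded r_def, symmetric])
      (simp add: scoeff_sum sscale_def)
  also have "\<dots> = (\<Sum>b | r b \<noteq> 0. if b = M_tensor I J then r b else 0)"
  proof (rule sum.cong)
    fix b assume "b \<in> {b. r b \<noteq> 0}"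
    then have "b \<in> B"
      unfolding r_def using biseries.representation_ne_zero by blast
    then obtain I' J' where b: "b = M_tensor I' J'"
      by (auto simp: B_def)
    show "r b * scoeff b (leading I, leading J) = (if b = M_tensor I J then r b else 0)"
      using scoeff_M_tensor_leading[of I' J' I J, where 'k = 'k]
        scoeff_M_tensor_leading[of I J I J, where 'k = 'k] by (auto simp: b)
  qed simp
  also have "\<dots> = r (M_tensor I J)"
    using fin r by simp
  finally show ?thesis
    using r by simp
qed

definition supported :: "'c::ab_semigroup_add multiset \<Rightarrow> ('c, 'k::field_char_0) biseries \<Rightarrow> bool" where
  "supported n f \<longleftrightarrow> (\<forall>m. scoeff f m \<noteq> 0 \<longrightarrow> size n = size (fst m) \<and>
     set_mset n \<subseteq> (\<lambda>(p, q). snd p + snd q) ` (set_mset (fst m) \<times> set_mset (snd m)))"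

lemma supported_one: "supported {#} 1"
  by (auto simp: supported_def one_fseries_def zero_prod_def)

lemma supported_mult:
  assumes "supported n f" "supported n' g"
  shows "supported (n + n') (f * g)"
  unfolding supported_def
proof (intro allI impI)
  fix m assume "scoeff (f * g) m \<noteq> 0"
  then obtain a b where m: "m = a + b" and a: "scoeff f a \<noteq> 0" and b: "scoeff g b \<noteq> 0"
    by (auto simp: times_fseries_def elim!: sum.not_neutral_contains_not_neutral)
  let ?T = "\<lambda>m. (\<lambda>(p, q). snd p + snd q) ` (set_mset (fst m) \<times> set_mset (snd m))"
  have "?T a \<subseteq> ?T m" "?T b \<subseteq> ?T m"
    by (force simp: m)+
  moreover have "set_mset n \<subseteq> ?T a" "set_mset n' \<subseteq> ?T b"
    and sz: "size n = size (fst a)" "size n' = size (fst b)"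
    using a b assms unfolding supported_def by blast+
  ultimately have "set_mset (n + n') \<subseteq> ?T m"
    by auto
  with sz show "size (n + n') = size (fst m) \<and> set_mset (n + n') \<subseteq> ?T m"
    by (simp add: m)
qed

lemma supported_varXY: "supported {#c#} (varXY p c)"
  unfolding supported_def
proof (intro allI impI)
  fix m assume "scoeff (varXY p c) m \<noteq> (0 :: 'b)"
  then obtain a b where ab: "a + b = c"
    and "scoeff (varX (fst p) a * varY (snd p) b) m \<noteq> (0 :: 'b)"
    by (auto simp: varXY_def scoeff_sum elim!: sum.not_neutral_contains_not_neutral)
  then have "m = ({#(fst p, a)#}, {#(snd p, b)#})"
    by (simp add: varX_def varY_def smonom_mult) (simp add: smonom_def split: if_splits)
  with ab show "size {#c#} = size (fst m) \<and>
      set_mset {#c#} \<subseteq> (\<lambda>(p, q). snd p + snd q) ` (set_mset (fst m) \<times> set_mset (snd m))"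
    by simp
qed

lemma supported_prod:
  "(\<And>i. i \<in> A \<Longrightarrow> supported (n i) (f i)) \<Longrightarrow> finite A \<Longrightarrow> supported (\<Sum>i\<in>A. n i) (\<Prod>i\<in>A. f i)"
  by (induction A rule: infinite_finite_induct) (simp_all add: supported_one supported_mult)

lemma supported_prod_varXY: "supported n (\<Prod>c\<in>#n. varXY p c)"
proof (induction n)
  case (add c n)
  then show ?case
    using supported_mult[OF supported_varXY[of c p] add] by simp
qed (simp add: supported_one)

lemma finite_delta_coeff: "finite {K. delta_coeff K I J \<noteq> (0 :: 'k::field_char_0)}"
proof -
  define s where "s = size (leading I)"
  define T where "T = (\<lambda>(p, q). snd p + snd q) ` (set_mset (leading I) \<times> set_mset (leading J))"
  define V where "V = {v :: 'a nzvec. set_mset (vec_of v) \<subseteq> T \<and> size (vec_of v) \<le> s}"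
  have "{n. set_mset n \<subseteq> T \<and> size n \<le> s} \<subseteq> mset ` {xs. set xs \<subseteq> T \<and> length xs \<le> s}"
  proof
    fix n assume n: "n \<in> {n. set_mset n \<subseteq> T \<and> size n \<le> s}"
    obtain xs where "mset xs = n"
      using ex_mset by blast
    with n show "n \<in> mset ` {xs. set xs \<subseteq> T \<and> length xs \<le> s}"
      by auto
  qed
  then have "finite {n. set_mset n \<subseteq> T \<and> size n \<le> s}"
    by (rule finite_subset) (simp add: finite_lists_length_le T_def)
  moreover have "vec_of ` V \<subseteq> {n. set_mset n \<subseteq> T \<and> size n \<le> s}"
    by (auto simp: V_def)
  ultimately have "finite (vec_of ` V)"
    by (rule finite_subset[rotated])
  then have V: "finite V"
    by (rule finite_imageD) (simp add: inj_on_def vec_of_inject)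
  have "{K. delta_coeff K I J \<noteq> (0 :: 'k)} \<subseteq> Word ` {ns. set ns \<subseteq> V \<and> length ns \<le> s}"
  proof
    fix K assume "K \<in> {K. delta_coeff K I J \<noteq> (0 :: 'k)}"
    then have "scoeff (delta_M K :: ('a, 'k) biseries) (leading I, leading J) \<noteq> 0"
      using delta_coeff_nonzero_imp by blast
    then obtain js where
      js: "scoeff ((\<Prod>l<length (letters K). \<Prod>c\<in>#vec_of (letters K ! l). varXY (js ! l) c) :: ('a, 'k) biseries)
        (leading I, leading J) \<noteq> 0"
      by (auto simp: delta_M_def M_eval_def fsum_def prod_power_count
          elim!: sum.not_neutral_contains_not_neutral)
    define N where "N = (\<Sum>l<length (letters K). vec_of (letters K ! l))"
    have "supported N ((\<Prod>l<length (letters K). \<Prod>c\<in>#vec_of (letters K ! l). varXY (js ! l) c) :: ('a, 'k) biseries)"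
      unfolding N_def by (rule supported_prod) (simp_all add: supported_prod_varXY)
    with js have N: "size N = s" "set_mset N \<subseteq> T"
      by (auto simp: supported_def s_def T_def)
    have size_N: "size N = (\<Sum>l<length (letters K). size (vec_of (letters K ! l)))"
      by (simp add: N_def size_multiset_sum)
    have "(\<Sum>l<length (letters K). 1) \<le> size N"
      unfolding size_N using vec_of_ne by (intro sum_mono) (simp add: Suc_le_eq nonempty_has_size[symmetric])
    then have "length (letters K) \<le> s"
      by (simp add: N)
    moreover have "set (letters K) \<subseteq> V"
    proof
      fix v assume "v \<in> set (letters K)"
      then obtain l where l: "l < length (letters K)" and v: "v = letters K ! l"
        by (auto simp: in_set_conv_nth)
      have "set_mset (vec_of v) \<subseteq> set_mset N"
        using l by (auto simp: N_def set_mset_sum v)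
      moreover have "size (vec_of v) \<le> size N"
        unfolding size_N v using l by (intro member_le_sum) auto
      ultimately show "v \<in> V"
        using N by (auto simp: V_def)
    qed
    ultimately show "K \<in> Word ` {ns. set ns \<subseteq> V \<and> length ns \<le> s}"
      by (intro image_eqI[where x = "letters K"]) simp_all
  qed
  then show ?thesis
    by (rule finite_subset) (use V in \<open>simp add: finite_lists_length_le\<close>)
qed

text \<open>\<open>S\<^sup>I \<star> S\<^sup>J = (\<Sum>K. delta_coeff K I J \<cdot> S\<^sup>K)\<close>, extended bilinearly.\<close>

lift_definition internal_prod ::
    "('c::{ab_semigroup_add, finite_decomp}, 'k::field_char_0) ncsym \<Rightarrow> ('c, 'k) ncsym \<Rightarrow> ('c, 'k) ncsym"
    (infixl "\<star>" 70) is
  "\<lambda>F G K. \<Sum>I | F I \<noteq> 0. \<Sum>J | G J \<noteq> 0. F I * G J * delta_coeff K I J"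
proof -
  fix F G :: "'c vcomp \<Rightarrow> 'k"
  assume F: "finite {I. F I \<noteq> 0}" and G: "finite {J. G J \<noteq> 0}"
  have "{K. (\<Sum>I | F I \<noteq> 0. \<Sum>J | G J \<noteq> 0. F I * G J * delta_coeff K I J) \<noteq> 0} \<subseteq>
      (\<Union>I\<in>{I. F I \<noteq> 0}. \<Union>J\<in>{J. G J \<noteq> 0}. {K. delta_coeff K I J \<noteq> (0 :: 'k)})"
  proof
    fix K assume "K \<in> {K. (\<Sum>I | F I \<noteq> 0. \<Sum>J | G J \<noteq> 0. F I * G J * delta_coeff K I J) \<noteq> 0}"
    then obtain I J where "F I \<noteq> 0" "G J \<noteq> 0" "delta_coeff K I J \<noteq> (0 :: 'k)"
      by (auto elim!: sum.not_neutral_contains_not_neutral)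
    then show "K \<in> (\<Union>I\<in>{I. F I \<noteq> 0}. \<Union>J\<in>{J. G J \<noteq> 0}. {K. delta_coeff K I J \<noteq> (0 :: 'k)})"
      by blast
  qed
  then show "finite {K. (\<Sum>I | F I \<noteq> 0. \<Sum>J | G J \<noteq> 0. F I * G J * delta_coeff K I J) \<noteq> 0}"
    by (rule finite_subset) (use F G finite_delta_coeff in blast)
qed

end

theory Submission
  imports Defs "HOL-Combinatorics.Permutations" "HOL-Library.Product_Lexorder"
begin

text \<open>The commutative image of \<open>S\<^sup>I\<close> is the product of the complete multi-symmetric functions \<open>h\<^sub>n\<close> over
  the parts of \<open>I\<close>, so it only depends on the type of \<open>I\<close>, the multiset of its parts. The \<open>h\<^sub>n\<close> are
  algebraically independent: products of power sums are triangular in the monomials, Newton's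
  identity (characteristic 0) writes power sums as polynomials in the \<open>h\<^sub>n\<close>, and in each multidegree
  both families are indexed by the same finite set of types. Hence two elements have the same
  commutative image iff, for every type, the sums of their coefficients over the vector compositions
  of that type agree.

  It remains to see that the sum over all \<open>K\<close> of a given type of the coefficients of \<open>S\<^sup>K\<close> in
  \<open>S\<^sup>I \<star> S\<^sup>J\<close> only depends on the types of \<open>I\<close> and \<open>J\<close>. By duality this sum is a coefficient of
  \<open>\<delta>(m)\<close>, where \<open>m\<close> is the sum of these \<open>M\<^sub>K\<close>, a monomial symmetric function. As \<open>m\<close> does not depend
  on the order of the positions, \<open>\<delta>(m)\<close> is invariant under all permutations of the rows and of the
  columns.\<close>

section \<open>Complete multi-symmetric functions\<close>

text \<open>In all series that build \<open>S_gen\<close>, the exponent of the commuting variables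
  is forced by the word, being the multiset of colors of its letters. Such a series amounts to a
  function on words.\<close>

definition graded :: "(('p \<times> 'c) list \<Rightarrow> 'k) \<Rightarrow> ('c multiset \<times> ('p \<times> 'c) fmon, 'k::ring_1) fseries" where
  "graded g = FSeries (\<lambda>(n, w). if n = mset (map snd (letters w)) then g (letters w) else 0)"

lemma scoeff_graded:
  "scoeff (graded g) (n, w) = (if n = mset (map snd (letters w)) then g (letters w) else 0)"
  by (simp add: graded_def)

text \<open>A cut of the word fixes both exponents as well, so the convolution over the product
  monoid collapses to a sum over the cut points of the word.\<close>

lemma graded_mult:
  "graded g * graded h = graded (\<lambda>w. \<Sum>k\<le>length w. g (take k w) * h (drop k w))"
proof (rule fseries_eqI)
  fix m :: "'a multiset \<times> ('b \<times> 'a) fmon"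
  obtain n w where m: "m = (n, w)" by force
  let ?c = "\<lambda>w. mset (map snd (letters w))"
  let ?t = "\<lambda>p. case p of (a, b) \<Rightarrow> scoeff (graded g) a * scoeff (graded h) b"
  let ?f = "\<lambda>k. ((?c (Word (take k (letters w))), Word (take k (letters w))),
                 (?c (Word (drop k (letters w))), Word (drop k (letters w))))"
  have spl: "?c w = ?c (Word (take k (letters w))) + ?c (Word (drop k (letters w)))" for k
    by (metis append_take_drop_id fmon.sel map_append mset_append)
  have "scoeff (graded g * graded h) m = (\<Sum>p\<in>{(a, b). a + b = (n, w)}. ?t p)"
    by (simp add: times_fseries_def m)
  also have "\<dots> = (\<Sum>p\<in>(if n = ?c w then ?f ` {..length (letters w)} else {}). ?t p)"
  proof (rule sum.mono_neutral_right)
    show "(if n = ?c w then ?f ` {..length (letters w)} else {}) \<subseteq> {(a, b). a + b = (n, w)}"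
      using spl by (auto simp: plus_fmon_def fmon.expand)
    show "\<forall>p\<in>{(a, b). a + b = (n, w)} - (if n = ?c w then ?f ` {..length (letters w)} else {}). ?t p = 0"
    proof (intro ballI, rule ccontr)
      fix p assume p: "p \<in> {(a, b). a + b = (n, w)} - (if n = ?c w then ?f ` {..length (letters w)} else {})"
        and ne: "?t p \<noteq> 0"
      obtain a u b v where abcd: "p = ((a, u), (b, v))" by (metis prod.exhaust)
      have ab: "a = ?c u" "b = ?c v" using ne by (auto simp: abcd scoeff_graded split: if_splits)
      have nw: "n = a + b" "w = u + v" using p by (auto simp: abcd)
      have "n = ?c w" using nw ab by (simp add: plus_fmon_def)
      moreover have "p = ?f (length (letters u))"
        using ab nw by (simp add: abcd plus_fmon_def)
      moreover have "length (letters u) \<le> length (letters w)" using nw by (simp add: plus_fmon_def)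
      ultimately show False using p by auto
    qed
  qed (rule finite_decomp)
  also have "\<dots> = (if n = ?c w then \<Sum>k\<le>length (letters w). g (take k (letters w)) * h (drop k (letters w)) else 0)"
  proof (cases "n = ?c w")
    case True
    have "inj_on ?f {..length (letters w)}"
    proof (rule inj_onI)
      fix k l assume k: "k \<in> {..length (letters w)}" and l: "l \<in> {..length (letters w)}" and "?f k = ?f l"
      then have "take k (letters w) = take l (letters w)" by simp
      then have "min (length (letters w)) k = min (length (letters w)) l" by (metis length_take)
      then show "k = l" using k l by simp
    qed
    then show ?thesis using True by (simp add: sum.reindex scoeff_graded)
  qed simp
  finally show "scoeff (graded g * graded h) m = scoeff (graded (\<lambda>w. \<Sum>k\<le>length w. g (take k w) * h (drop k w))) m"
    by (simp add: m scoeff_graded)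
qed

lemma graded_one: "1 = graded (\<lambda>w. if w = [] then 1 else 0)"
  by (auto intro!: fseries_eqI simp: one_fseries_def graded_def zero_fmon_def zero_prod_def fmon.expand)

text \<open>The sum may run over infinitely many colors, but each monomial occurs in at most one
  member.\<close>

lemma letter_series:
  "fsum UNIV (\<lambda>c. smonom ({#c#}, Word [(i, c)])) =
    graded (\<lambda>w. if \<exists>c. w = [(i, c)] then 1 else 0 :: 'k::ring_1)"
proof (rule fseries_eqI)
  fix m :: "'a multiset \<times> ('b \<times> 'a) fmon"
  obtain n w where m: "m = (n, Word w)" by (metis fmon.exhaust prod.exhaust)
  have "scoeff (fsum UNIV (\<lambda>c. smonom ({#c#}, Word [(i, c)])) :: (_, 'k) fseries) m =
     (\<Sum>c\<in>{c. n = {#c#} \<and> w = [(i, c)]}. 1)"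
    unfolding fsum_def smonom_def by (auto simp: m intro!: sum.cong)
  also have "\<dots> = scoeff (graded (\<lambda>w. if \<exists>c. w = [(i, c)] then 1 else 0 :: 'k)) m"
  proof (cases "\<exists>c. w = [(i, c)]")
    case True
    then obtain c where "w = [(i, c)]" by blast
    then have "{c. n = {#c#} \<and> w = [(i, c)]} = (if n = {#c#} then {c} else {})" by auto
    then show ?thesis using \<open>w = _\<close> by (auto simp: m scoeff_graded)
  next
    case False
    then show ?thesis by (auto simp: m scoeff_graded)
  qed
  finally show "scoeff (fsum UNIV (\<lambda>c. smonom ({#c#}, Word [(i, c)])) :: (_, 'k) fseries) m =
     scoeff (graded (\<lambda>w. if \<exists>c. w = [(i, c)] then 1 else 0 :: 'k)) m" .
qed

lemma graded_diff: "graded g - graded h = graded (\<lambda>w. g w - h w)"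
  by (auto intro!: fseries_eqI simp: minus_fseries_def graded_def)

lemma ring_inv_eqI: "u * v = 1 \<Longrightarrow> v * u = 1 \<Longrightarrow> ring_inv u = (v :: 'r::ring_1)"
  unfolding ring_inv_def by (rule the_equality) (auto, metis mult.assoc mult_1_left mult_1_right)

text \<open>This is the geometric series: the inverse is the sum of all words whose letters have
  position \<open>i\<close>. Since \<open>ring_inv\<close> asks for a two-sided inverse, both
  products are computed.\<close>

lemma ring_inv_letter_series:
  "ring_inv (1 - fsum UNIV (\<lambda>c. smonom ({#c#}, Word [(i, c)]))) =
    graded (\<lambda>w. if \<forall>x\<in>set w. fst x = i then 1 else 0 :: 'k::ring_1)"
proof -
  define l :: "('b \<times> 'a) list \<Rightarrow> 'k" where "l = (\<lambda>w. (if w = [] then 1 else 0) - (if \<exists>c. w = [(i, c)] then 1 else 0))"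
  define g :: "('b \<times> 'a) list \<Rightarrow> 'k" where "g = (\<lambda>w. if \<forall>x\<in>set w. fst x = i then 1 else 0)"
  have l0: "length w > 1 \<Longrightarrow> l w = 0" for w by (auto simp: l_def)
  have l1: "l [] = 1" "l [x] = - (if fst x = i then 1 else 0)" for x by (auto simp: l_def prod_eq_iff)
  have "(\<Sum>k\<le>length w. l (take k w) * g (drop k w)) = (if w = [] then 1 else 0)" for w
  proof (cases w)
    case (Cons x xs)
    \<comment> \<open>As \<open>l\<close> vanishes on words with more than one letter, only two cuts
      of a nonempty word survive, and their terms cancel. The other product is treated likewise from
      the end of the word.\<close>
    have "(\<Sum>k\<le>length w. l (take k w) * g (drop k w)) = (\<Sum>k\<in>{0, 1}. l (take k w) * g (drop k w))"
    proof (rule sum.mono_neutral_right)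
      show "\<forall>k\<in>{..length w} - {0, 1}. l (take k w) * g (drop k w) = 0"
        using l0[of "take _ w"] by (simp add: min_def)
    qed (auto simp: Cons)
    then show ?thesis by (simp add: Cons l1) (simp add: g_def)
  qed (simp add: l1 g_def)
  moreover have "(\<Sum>k\<le>length w. g (take k w) * l (drop k w)) = (if w = [] then 1 else 0)" for w
  proof (cases w rule: rev_cases)
    case (snoc xs x)
    have "(\<Sum>k\<le>length w. g (take k w) * l (drop k w)) = (\<Sum>k\<in>{length xs, Suc (length xs)}. g (take k w) * l (drop k w))"
    proof (rule sum.mono_neutral_right)
      show "\<forall>k\<in>{..length w} - {length xs, Suc (length xs)}. g (take k w) * l (drop k w) = 0"
      proof
        fix k assume "k \<in> {..length w} - {length xs, Suc (length xs)}"
        then have "length (drop k w) > 1" by (auto simp: snoc)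
        then show "g (take k w) * l (drop k w) = 0" using l0 by simp
      qed
    qed (auto simp: snoc)
    then show ?thesis by (simp add: snoc l1) (simp add: g_def)
  qed (simp add: l1 g_def)
  ultimately have "graded l * graded g = 1" "graded g * graded l = 1"
    by (simp_all add: graded_mult graded_one)
  then have "ring_inv (graded l) = graded g" by (rule ring_inv_eqI)
  then show ?thesis by (simp add: letter_series graded_one graded_diff l_def g_def)
qed

lemma sorted_map_const: "\<forall>x\<in>set xs. f x = (a :: 'a::linorder) \<Longrightarrow> sorted (map f xs)"
  by (induction xs) auto

text \<open>Multiplying by the factor of position \<open>N\<close> appends letters of that position.
  A sorted word with positions below \<open>Suc N\<close> has exactly one cut into letters below
  \<open>N\<close> and letters at \<open>N\<close>.\<close>

lemma partial_prod_letter_series: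
  "prod_list (map (\<lambda>i. graded (\<lambda>w. if \<forall>x\<in>set w. fst x = i then 1 else 0)) [0..<N]) =
    graded (\<lambda>w :: (nat \<times> 'c) list. if sorted (map fst w) \<and> (\<forall>x\<in>set w. fst x < N) then 1 else 0 :: 'k::ring_1)"
proof (induction N)
  case 0
  have "(sorted (map fst w) \<and> (\<forall>x\<in>set w. fst x < 0)) = (w = [])" for w :: "(nat \<times> 'c) list"
    by (cases w) auto
  then show ?case by (simp only: upt_rec[of 0 0] list.map prod_list.Nil graded_one less_irrefl if_False)
next
  case (Suc N)
  have "(\<Sum>k\<le>length w. (if sorted (map fst (take k w)) \<and> (\<forall>x\<in>set (take k w). fst x < N) then 1 else 0 :: 'k) *
      (if \<forall>x\<in>set (drop k w). fst x = N then 1 else 0)) =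
      (if sorted (map fst w) \<and> (\<forall>x\<in>set w. fst x < Suc N) then 1 else 0)" (is "?l w = ?r w") for w :: "(nat \<times> 'c) list"
  proof -
    let ?P = "\<lambda>k. k \<le> length w \<and> sorted (map fst (take k w)) \<and> (\<forall>x\<in>set (take k w). fst x < N) \<and> (\<forall>x\<in>set (drop k w). fst x = N)"
    have l: "?l w = (\<Sum>k\<in>{k. ?P k}. 1)"
      by (rule sum.mono_neutral_cong_right) auto
    \<comment> \<open>An admissible cut can only lie at the end of the longest prefix with positions
      below \<open>N\<close>, so the sum is 0 or 1.\<close>
    have tw: "k = length (takeWhile (\<lambda>x. fst x < N) w)" if "?P k" for k
    proof -
      have "takeWhile (\<lambda>x. fst x < N) (take k w @ drop k w) = take k w"
        using that by (subst takeWhile_append2) (auto simp: takeWhile_eq_Nil_iff dest: hd_in_set)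
      then show ?thesis using that by simp
    qed
    show ?thesis
    proof (cases "sorted (map fst w) \<and> (\<forall>x\<in>set w. fst x < Suc N)")
      case True
      define k where "k = length (takeWhile (\<lambda>x. fst x < N) w)"
      have tk: "take k w = takeWhile (\<lambda>x. fst x < N) w" "drop k w = dropWhile (\<lambda>x. fst x < N) w"
        unfolding k_def by (rule takeWhile_eq_take[symmetric], rule dropWhile_eq_drop[symmetric])
      have "fst x = N" if x: "x \<in> set (dropWhile (\<lambda>x. fst x < N) w)" for x
      proof -
        have ne: "dropWhile (\<lambda>x. fst x < N) w \<noteq> []" using x by (metis list.set(1) empty_iff)
        have s: "sorted (map fst (dropWhile (\<lambda>x. fst x < N) w))"
          using True tk(2) by (metis drop_map sorted_wrt_drop)
        have "\<not> fst (hd (dropWhile (\<lambda>x. fst x < N) w)) < N" using hd_dropWhile[OF ne] by simp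
        moreover have "fst (hd (dropWhile (\<lambda>x. fst x < N) w)) \<le> fst x"
          using s x ne by (cases "dropWhile (\<lambda>x. fst x < N) w") auto
        moreover have "fst x < Suc N" using True x by (meson set_dropWhileD)
        ultimately show ?thesis by simp
      qed
      then have "\<forall>x\<in>set (drop k w). fst x = N" unfolding tk by blast
      moreover have "\<forall>x\<in>set (take k w). fst x < N" unfolding tk using set_takeWhileD by metis
      moreover have "sorted (map fst (take k w))" using True by (simp add: take_map[symmetric] sorted_wrt_take)
      moreover have "k \<le> length w" by (simp add: k_def length_takeWhile_le)
      ultimately have "?P k" by blast
      then have "{k. ?P k} = {k}" using tw by blast
      then show ?thesis unfolding l if_P[OF True] by simp
    next
      case False
      have "\<not> ?P k" for k
      proof
        assume P: "?P k"
        have "sorted (map fst (take k w @ drop k w)) \<and> (\<forall>x\<in>set (take k w @ drop k w). fst x < Suc N)"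
        proof -
          define u v where "u = take k w" and "v = drop k w"
          have "sorted (map fst u)" "\<forall>x\<in>set u. fst x < N" "\<forall>x\<in>set v. fst x = N"
            using P unfolding u_def v_def by blast+
          then have "sorted (map fst (u @ v)) \<and> (\<forall>x\<in>set (u @ v). fst x < Suc N)"
            using sorted_map_const[of v fst N] by (force simp: sorted_append)
          then show ?thesis unfolding u_def v_def .
        qed
        with False show False by simp
      qed
      then have "{k. ?P k} = {}" by blast
      then show ?thesis unfolding l if_not_P[OF False] by (simp only: sum.empty)
    qed
  qed
  then show ?case by (simp add: Suc graded_mult)
qed

text \<open>The coefficient of a word is constant once \<open>N\<close> exceeds all its positions,
  so the eventual value in \<open>ordered_prod\<close> exists.\<close>

lemma S_gen_eq: "S_gen = graded (\<lambda>w. if sorted (map fst w) then 1 else 0)"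
proof (rule fseries_eqI)
  fix m :: "'a multiset \<times> (nat \<times> 'a) fmon"
  obtain n w where m: "m = (n, Word w)" by (metis fmon.exhaust prod.exhaust)
  let ?g = "\<lambda>N. graded (\<lambda>w. if sorted (map fst w) \<and> (\<forall>x\<in>set w. fst x < N) then 1 else 0) :: ('a multiset \<times> (nat \<times> 'a) fmon, 'b) fseries"
  let ?v = "scoeff (graded (\<lambda>w. if sorted (map fst w) then 1 else 0) :: ('a multiset \<times> (nat \<times> 'a) fmon, 'b) fseries) m"
  obtain N0 where "\<forall>x\<in>set w. fst x < N0"
    by (metis finite_nat_set_iff_bounded finite_imageI finite_set image_eqI)
  then have ev: "\<forall>\<^sub>F N in sequentially. scoeff (?g N) m = ?v"
    unfolding eventually_sequentially by (intro exI[of _ N0]) (auto simp: m scoeff_graded)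
  have "(THE a. \<forall>\<^sub>F N in sequentially. scoeff (?g N) m = a) = ?v"
  proof (rule the_equality, rule ev)
    fix a assume "\<forall>\<^sub>F N in sequentially. scoeff (?g N) m = a"
    with ev have "\<forall>\<^sub>F N in sequentially. a = ?v" by eventually_elim simp
    then show "a = ?v" by simp
  qed
  then show "scoeff S_gen m = ?v"
    by (simp add: S_gen_def ordered_prod_def ring_inv_letter_series partial_prod_letter_series)
qed

lemma scoeff_S_real:
  "scoeff (S_real n) w = (if n = mset (map snd (letters w)) \<and> sorted (map fst (letters w)) then 1 else 0)"
  by (simp add: S_real_def S_gen_eq scoeff_graded)

section \<open>Commutative images of the generators and their products\<close>

lemma finite_words_mset: "finite {w. mset (letters w) = m}"
proof (cases "\<exists>xs. mset xs = m")
  case True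
  then obtain xs where "mset xs = m" by blast
  have "finite {ys. mset ys = mset xs}" by (rule finite_subset[OF _ finite_lists_length_eq[of "set xs" "length xs"]])
     (auto dest: mset_eq_length mset_eq_setD)
  then have "finite (Word ` {ys. mset ys = mset xs})" by simp
  then show ?thesis by (rule rev_finite_subset) (auto simp: \<open>mset xs = m\<close> intro!: image_eqI[of _ _ "letters _"])
next
  case False
  then have "{w. mset (letters w) = m} = {}" by auto
  then show ?thesis by (simp only: finite.emptyI)
qed

text \<open>Both sides sum over pairs of words whose letters together make up \<open>m\<close>; on
  the right the pairs are grouped by the multisets of letters of the two words.\<close>

lemma abelianize_mult:
  fixes f g :: "('v fmon, 'k::ring_1) fseries"
  shows "abelianize (f * g) = abelianize f * abelianize g"
proof (rule fseries_eqI)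
  fix m :: "'v multiset"
  let ?W = "\<lambda>m :: 'v multiset. {w. mset (letters w) = m}"
  have "scoeff (abelianize (f * g)) m = (\<Sum>w\<in>?W m. \<Sum>p\<in>{(u, v). u + v = w}. scoeff f (fst p) * scoeff g (snd p))"
    by (simp add: abelianize_def times_fseries_def split_beta)
  also have "\<dots> = (\<Sum>(w, p)\<in>(SIGMA w:?W m. {(u, v). u + v = w}). scoeff f (fst p) * scoeff g (snd p))"
    by (rule sum.Sigma) (auto intro: finite_words_mset finite_decomp)
  also have "\<dots> = (\<Sum>(q, p)\<in>(SIGMA q:{(a, b). a + b = m}. ?W (fst q) \<times> ?W (snd q)). scoeff f (fst p) * scoeff g (snd p))"
    by (rule sum.reindex_bij_witness[where
          i = "\<lambda>(q, p). (fst p + snd p, p)" and j = "\<lambda>(w, p). ((mset (letters (fst p)), mset (letters (snd p))), p)"])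
      (auto simp: plus_fmon_def)
  also have "\<dots> = (\<Sum>q\<in>{(a, b). a + b = m}. \<Sum>p\<in>?W (fst q) \<times> ?W (snd q). scoeff f (fst p) * scoeff g (snd p))"
    by (rule sum.Sigma[symmetric]) (auto intro: finite_words_mset finite_decomp)
  also have "\<dots> = (\<Sum>q\<in>{(a, b). a + b = m}. (\<Sum>u\<in>?W (fst q). scoeff f u) * (\<Sum>v\<in>?W (snd q). scoeff g v))"
    by (simp add: sum_product sum.cartesian_product split_beta)
  also have "\<dots> = scoeff (abelianize f * abelianize g) m"
    by (simp add: abelianize_def times_fseries_def split_beta)
  finally show "scoeff (abelianize (f * g)) m = scoeff (abelianize f * abelianize g) m" .
qed

lemma abelianize_one: "abelianize 1 = (1 :: ('v multiset, 'k::ring_1) fseries)"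
proof (rule fseries_eqI)
  fix m :: "'v multiset"
  have "scoeff (abelianize 1 :: ('v multiset, 'k) fseries) m = (\<Sum>w\<in>(if m = 0 then {0 :: 'v fmon} else {}). scoeff 1 w)"
    unfolding abelianize_def fseries.sel
    by (rule sum.mono_neutral_cong_right)
      (auto simp: finite_words_mset one_fseries_def zero_fmon_def split: if_splits)
  then show "scoeff (abelianize 1 :: ('v multiset, 'k) fseries) m = scoeff 1 m"
    by (simp add: one_fseries_def)
qed

lemma abelianize_sum: "abelianize (\<Sum>i\<in>A. sscale (c i) (f i)) = (\<Sum>i\<in>A. sscale (c i) (abelianize (f i)))"
  for f :: "'i \<Rightarrow> ('v fmon, 'k::ring_1) fseries"
  by (rule fseries_eqI) (simp add: abelianize_def scoeff_sum sscale_def sum_distrib_left sum.swap[of _ A])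

text \<open>The complete multi-symmetric function \<open>h_n\<close>, as the commutative image of
  \<open>S_n\<close>.\<close>

definition hsym :: "'c multiset \<Rightarrow> ((nat \<times> 'c) multiset, 'k::field_char_0) fseries" where
  "hsym n = abelianize (S_real n)"

definition sorted_words :: "(nat \<times> 'c) multiset \<Rightarrow> (nat \<times> 'c) list set" where
  "sorted_words m = {w. mset w = m \<and> sorted (map fst w)}"

text \<open>Only the positions are sorted: letters sharing a position may stand in any order. The
  coefficient is therefore a product of multinomial coefficients, one for each position.\<close>

lemma scoeff_hsym:
  "scoeff (hsym n) m = (if image_mset snd m = n then of_nat (card (sorted_words m)) else 0)"
proof -
  have "scoeff (hsym n :: (_, 'a) fseries) m = (\<Sum>w\<in>(if image_mset snd m = n then Word ` sorted_words m else {}). 1)"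
    unfolding hsym_def abelianize_def fseries.sel
  proof (rule sum.mono_neutral_cong_right)
    show "\<forall>w\<in>{w. mset (letters w) = m} - (if image_mset snd m = n then Word ` sorted_words m else {}).
        scoeff (S_real n) w = (0 :: 'a)"
      by (auto simp: sorted_words_def scoeff_S_real image_iff) (metis fmon.exhaust_sel)
  qed (auto simp: finite_words_mset sorted_words_def scoeff_S_real split: if_splits)
  then show ?thesis by (simp add: card_image inj_on_def)
qed

definition hprod :: "'c nzvec multiset \<Rightarrow> ((nat \<times> 'c) multiset, 'k::field_char_0) fseries" where
  "hprod L = (\<Prod>n\<in>#L. hsym (vec_of n))"

lemma abelianize_prod_S_real:
  "abelianize (prod_list (map (\<lambda>n. S_real (vec_of n)) ns)) = hprod (mset ns)"
  by (induction ns) (simp_all add: abelianize_one abelianize_mult hsym_def hprod_def)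

text \<open>The index set may exceed the support, so that several elements can be expanded over a
  common one.\<close>

lemma comm_image_eq:
  assumes "finite A" "Poly_Mapping.keys F \<subseteq> A"
  shows "comm_image F = (\<Sum>I\<in>A. sscale (Poly_Mapping.lookup F I) (hprod (mset (letters I))))"
proof -
  have "comm_image F = (\<Sum>I\<in>Poly_Mapping.keys F. sscale (Poly_Mapping.lookup F I) (hprod (mset (letters I))))"
    by (simp add: comm_image_def realize_def abelianize_sum abelianize_prod_S_real)
  also have "\<dots> = (\<Sum>I\<in>A. sscale (Poly_Mapping.lookup F I) (hprod (mset (letters I))))"
    by (rule sum.mono_neutral_left) (use assms in \<open>auto simp: in_keys_iff sscale_def zero_fseries_def\<close>)
  finally show ?thesis .
qed

section \<open>Power sums and Newton's identity\<close>

text \<open>Arrangements of the letters of \<open>m\<close>, provided they all share one position.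
  Their number is a multinomial coefficient, the weight with which such a monomial occurs in
  \<open>qsym\<close>.\<close>

definition blocks :: "('p \<times> 'c) multiset \<Rightarrow> ('p \<times> 'c) list set" where
  "blocks m = {w. mset w = m \<and> w \<noteq> [] \<and> (\<exists>j. \<forall>x\<in>set w. fst x = j)}"

lemma finite_mset_lists: "finite {w. mset w = m \<and> P w}"
proof -
  have "{w. mset w = m \<and> P w} \<subseteq> letters ` {w. mset (letters w) = m}"
    by (force intro: image_eqI[where x = "Word _"])
  then show ?thesis by (rule finite_subset) (simp add: finite_words_mset)
qed

lemma dropWhile_less_sorted:
  "sorted (map f w) \<Longrightarrow> x \<in> set (dropWhile (\<lambda>x. f x < j) w) \<Longrightarrow> (j :: 'a::linorder) \<le> f x"
  by (induction w) (auto split: if_splits)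

text \<open>A sorted word with a marked letter is cut as \<open>A @ u @ B\<close>, where the nonempty block \<open>u\<close> ends at
  the marked letter and starts at the first letter with the same position; removing \<open>u\<close> leaves an
  arbitrary sorted word.\<close>

lemma card_marked_sorted_words:
  "size m * card (sorted_words m) = (\<Sum>p\<in>{(a, b). a + b = m}. card (sorted_words (fst p)) * card (blocks (snd p)))"
proof -
  define T where "T = {(A, u, B). mset (A @ u @ B) = m \<and> sorted (map fst (A @ u @ B)) \<and> u \<noteq> [] \<and>
    (\<exists>j. (\<forall>x\<in>set u. fst x = j) \<and> (\<forall>x\<in>set A. fst x < j))}"
  define R where "R = {(w, b). mset w + mset b = m \<and> sorted (map fst w) \<and> b \<noteq> [] \<and> (\<exists>j. \<forall>x\<in>set b. fst x = j)}"
  let ?tw = "\<lambda>j. takeWhile (\<lambda>x. fst x < j)" and ?dw = "\<lambda>j. dropWhile (\<lambda>x. fst x < j)"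
  \<comment> \<open>The mark is the index of the last letter of \<open>u\<close>, counted from 1;
    the inverse map reads the common position \<open>j\<close> of the block off
    \<open>w ! (k - 1)\<close>.\<close>
  have "bij_betw (\<lambda>(A, u, B). (A @ u @ B, length (A @ u))) T (sorted_words m \<times> {1..size m})"
  proof (rule bij_betw_byWitness[where f' = "\<lambda>(w, k). let j = fst (w ! (k - 1)) in (?tw j (take k w), ?dw j (take k w), drop k w)"])
    show "\<forall>t\<in>T. (\<lambda>(w, k). let j = fst (w ! (k - 1)) in (?tw j (take k w), ?dw j (take k w), drop k w))
        ((\<lambda>(A, u, B). (A @ u @ B, length (A @ u))) t) = t"
    proof
      fix t assume "t \<in> T"
      moreover obtain A u B where t: "t = (A, u, B)" by (cases t)
      ultimately obtain j where u: "u \<noteq> []" and j: "\<forall>x\<in>set u. fst x = j" "\<forall>x\<in>set A. fst x < j"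
        by (auto simp: T_def)
      have "(A @ u @ B) ! (length (A @ u) - 1) = last u"
        using u by (cases u rule: rev_cases) (simp_all add: nth_append)
      then have "fst ((A @ u @ B) ! (length (A @ u) - 1)) = j" using u j by simp
      moreover have "?tw j u = []" "?dw j u = u"
        using u j by (cases u; simp)+
      ultimately show "(\<lambda>(w, k). let j = fst (w ! (k - 1)) in (?tw j (take k w), ?dw j (take k w), drop k w))
        ((\<lambda>(A, u, B). (A @ u @ B, length (A @ u))) t) = t"
        using j unfolding t by (simp add: Let_def takeWhile_append2 dropWhile_append2)
    qed
    have *: "(?tw j (take k w), ?dw j (take k w), drop k w) \<in> T"
      if w: "w \<in> sorted_words m" and k: "k \<in> {1..size m}" and j: "j = fst (w ! (k - 1))" for w k j
    proof -
      have lw: "length w = size m" using w by (auto simp: sorted_words_def)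
      define v where "v = take k w"
      have v0: "v \<noteq> []" using k lw by (auto simp: v_def)
      have "last v = w ! (k - 1)" unfolding last_conv_nth[OF v0] using k lw by (simp add: v_def)
      note v = v0 this
      have sv: "sorted (map fst v)" using w by (simp add: sorted_words_def v_def take_map[symmetric] sorted_wrt_take)
      have le: "fst x \<le> j" if "x \<in> set v" for x
        using sv v that unfolding j by (cases v rule: rev_cases) (auto simp: sorted_append)
      have "fst x = j" if "x \<in> set (?dw j v)" for x
        using dropWhile_less_sorted[OF sv that] le[OF set_dropWhileD[OF that]] by simp
      moreover have "\<forall>x\<in>set (?tw j v). fst x < j" using set_takeWhileD by metis
      moreover have "?dw j v \<noteq> []"
      proof
        assume "?dw j v = []"
        then have "fst (last v) < j" by (metis dropWhile_eq_Nil_conv last_in_set v0)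
        with v j show False by simp
      qed
      moreover have eq: "?tw j v @ ?dw j v @ drop k w = w"
        unfolding append_assoc[symmetric] takeWhile_dropWhile_id v_def by (rule append_take_drop_id)
      moreover have "mset (?tw j v @ ?dw j v @ drop k w) = m" "sorted (map fst (?tw j v @ ?dw j v @ drop k w))"
        unfolding eq using w by (simp_all add: sorted_words_def)
      ultimately show ?thesis unfolding T_def v_def[symmetric] by blast
    qed
    show "\<forall>q\<in>sorted_words m \<times> {1..size m}. (\<lambda>(A, u, B). (A @ u @ B, length (A @ u)))
       ((\<lambda>(w, k). let j = fst (w ! (k - 1)) in (?tw j (take k w), ?dw j (take k w), drop k w)) q) = q"
    proof
      fix q assume "q \<in> sorted_words m \<times> {1..size m}"
      then obtain w k where q: "q = (w, k)" and w: "w \<in> sorted_words m" and k: "k \<in> {1..size m}"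
        by blast
      have lw: "length w = size m" using w by (auto simp: sorted_words_def)
      show "(\<lambda>(A, u, B). (A @ u @ B, length (A @ u)))
       ((\<lambda>(w, k). let j = fst (w ! (k - 1)) in (?tw j (take k w), ?dw j (take k w), drop k w)) q) = q"
        unfolding q using k lw by (simp add: Let_def flip: append_assoc length_append)
    qed
    show "(\<lambda>(A, u, B). (A @ u @ B, length (A @ u))) ` T \<subseteq> sorted_words m \<times> {1..size m}"
      by (auto simp: T_def sorted_words_def Suc_le_eq)
    show "(\<lambda>(w, k). let j = fst (w ! (k - 1)) in (?tw j (take k w), ?dw j (take k w), drop k w)) `
        (sorted_words m \<times> {1..size m}) \<subseteq> T"
      using * by (auto simp: Let_def)
  qed
  then have "card T = card (sorted_words m \<times> {1..size m})" by (rule bij_betw_same_card)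
  then have 1: "card T = size m * card (sorted_words m)" by (simp add: card_cartesian_product)
  \<comment> \<open>The position of the block determines where it goes back: after all letters of
    smaller position and before all others.\<close>
  have "bij_betw (\<lambda>(A, u, B). (A @ B, u)) T R"
  proof (rule bij_betw_byWitness[where f' = "\<lambda>(w, b). (?tw (fst (hd b)) w, b, ?dw (fst (hd b)) w)"])
    show "\<forall>t\<in>T. (\<lambda>(w, b). (?tw (fst (hd b)) w, b, ?dw (fst (hd b)) w)) ((\<lambda>(A, u, B). (A @ B, u)) t) = t"
    proof
      fix t assume "t \<in> T"
      moreover obtain A u B where t: "t = (A, u, B)" by (cases t)
      ultimately obtain j where u: "u \<noteq> []" and j: "\<forall>x\<in>set u. fst x = j" "\<forall>x\<in>set A. fst x < j"
        and s: "sorted (map fst (A @ u @ B))"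
        by (auto simp: T_def)
      have h: "fst (hd u) = j" using u j by simp
      have "\<forall>x\<in>set B. j \<le> fst x" using u h s by (cases u) (auto simp: sorted_append)
      then have "?tw j B = []" "?dw j B = B" by (cases B; force)+
      then show "(\<lambda>(w, b). (?tw (fst (hd b)) w, b, ?dw (fst (hd b)) w)) ((\<lambda>(A, u, B). (A @ B, u)) t) = t"
        using j h unfolding t by (simp add: takeWhile_append2 dropWhile_append2)
    qed
    show "\<forall>q\<in>R. (\<lambda>(A, u, B). (A @ B, u)) ((\<lambda>(w, b). (?tw (fst (hd b)) w, b, ?dw (fst (hd b)) w)) q) = q"
      by auto
    show "(\<lambda>(A, u, B). (A @ B, u)) ` T \<subseteq> R"
      by (auto simp: T_def R_def sorted_append)
    show "(\<lambda>(w, b). (?tw (fst (hd b)) w, b, ?dw (fst (hd b)) w)) ` R \<subseteq> T"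
    proof (rule image_subsetI)
      fix q assume "q \<in> R"
      then obtain w b where q: "q = (w, b)" and wb: "(w, b) \<in> R" by (cases q) auto
      define j where "j = fst (hd b)"
      from wb obtain j' where "b \<noteq> []" and j': "\<forall>x\<in>set b. fst x = j'" by (auto simp: R_def)
      then have "j' = j" by (simp add: j_def)
      with wb j' have b: "b \<noteq> []" "\<forall>x\<in>set b. fst x = j" and s: "sorted (map fst w)" and m: "mset w + mset b = m"
        by (auto simp: R_def)
      have A: "\<forall>x\<in>set (?tw j w). fst x < j" using set_takeWhileD by metis
      have B: "\<forall>x\<in>set (?dw j w). j \<le> fst x" using dropWhile_less_sorted[OF s] by blast
      have s': "sorted (map fst (?tw j w @ ?dw j w))" using s by simp
      have "sorted (map fst (?tw j w @ b @ ?dw j w))"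
        using s' A B b sorted_map_const[OF b(2)] unfolding map_append sorted_append by fastforce
      moreover have "mset (?tw j w @ b @ ?dw j w) = m"
        using m by (metis add.commute add.left_commute mset_append takeWhile_dropWhile_id)
      ultimately have "(?tw j w, b, ?dw j w) \<in> T" using A b unfolding T_def by blast
      then show "(\<lambda>(w, b). (?tw (fst (hd b)) w, b, ?dw (fst (hd b)) w)) q \<in> T"
        by (simp add: q j_def)
    qed
  qed
  then have "card T = card R" by (rule bij_betw_same_card)
  also have "card R = card (SIGMA p:{(a, b). a + b = m}. sorted_words (fst p) \<times> blocks (snd p))"
    by (rule bij_betw_same_card[OF bij_betw_byWitness[where f = "\<lambda>(w, b). ((mset w, mset b), (w, b))" and f' = snd]])
      (auto simp: R_def sorted_words_def blocks_def)
  also have "\<dots> = (\<Sum>p\<in>{(a, b). a + b = m}. card (sorted_words (fst p)) * card (blocks (snd p)))"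
    by (subst card_SigmaI)
      (auto simp: card_cartesian_product finite_decomp sorted_words_def blocks_def finite_mset_lists)
  finally show ?thesis using 1 by simp
qed

text \<open>A power sum, up to a multinomial coefficient.\<close>

definition qsym :: "'c multiset \<Rightarrow> ((nat \<times> 'c) multiset, 'k::field_char_0) fseries" where
  "qsym n = FSeries (\<lambda>m. if image_mset snd m = n then of_nat (card (blocks m)) else 0)"

text \<open>Coefficientwise this is the count \<open>card_marked_sorted_words\<close>. It is the
  multi-symmetric form of Newton's relation between complete functions and power sums.\<close>

lemma newton_identity:
  "sscale (of_nat (size n)) (hsym n) = (\<Sum>p\<in>{(a, b). a + b = n}. hsym (fst p) * qsym (snd p))"
proof (rule fseries_eqI)
  fix m :: "(nat \<times> 'a) multiset"
  let ?t = "\<lambda>q. of_nat (card (sorted_words (fst q)) * card (blocks (snd q))) :: 'b"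
  let ?c = "image_mset snd :: (nat \<times> 'a) multiset \<Rightarrow> 'a multiset"
  have "scoeff (\<Sum>p\<in>{(a, b). a + b = n}. hsym (fst p) * qsym (snd p) :: (_, 'b) fseries) m =
     (\<Sum>q\<in>{(a, b). a + b = m}. \<Sum>p\<in>{(a, b). a + b = n}. scoeff (hsym (fst p) :: (_, 'b) fseries) (fst q) * scoeff (qsym (snd p)) (snd q))"
    by (simp add: scoeff_sum times_fseries_def split_beta sum.swap[of _ "{(a, b). a + b = n}"])
  \<comment> \<open>For a factorization \<open>q\<close> of the monomial, the only splitting of
    \<open>n\<close> that contributes is the one given by the colors of the two factors.\<close>
  also have "\<dots> = (\<Sum>q\<in>{(a, b). a + b = m}. if ?c m = n then ?t q else 0)"
  proof (rule sum.cong)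
    fix q assume q: "q \<in> {(a, b). a + b = m}"
    have "(\<Sum>p\<in>{(a, b). a + b = n}. scoeff (hsym (fst p) :: (_, 'b) fseries) (fst q) * scoeff (qsym (snd p)) (snd q)) =
      (\<Sum>p\<in>{(a, b). a + b = n}. if p = (?c (fst q), ?c (snd q)) then ?t q else 0)"
      by (rule sum.cong) (auto simp: scoeff_hsym qsym_def)
    also have "\<dots> = (if ?c m = n then ?t q else 0)"
      using q by (auto simp: finite_decomp)
    finally show "(\<Sum>p\<in>{(a, b). a + b = n}. scoeff (hsym (fst p) :: (_, 'b) fseries) (fst q) * scoeff (qsym (snd p)) (snd q)) =
      (if ?c m = n then ?t q else 0)" .
  qed simp
  also have "\<dots> = (if ?c m = n then of_nat (size m * card (sorted_words m)) else 0)"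
    by (simp only: card_marked_sorted_words of_nat_sum) simp
  finally show "scoeff (sscale (of_nat (size n)) (hsym n)) m =
     scoeff (\<Sum>p\<in>{(a, b). a + b = n}. hsym (fst p) * qsym (snd p) :: (_, 'b) fseries) m"
    by (auto simp: sscale_def scoeff_hsym)
qed

interpretation fser: vector_space "sscale :: 'k::field \<Rightarrow> ('m, 'k) fseries \<Rightarrow> ('m::{monoid_add, finite_decomp}, 'k) fseries"
  by standard
    (simp_all add: sscale_def plus_fseries_def distrib_left distrib_right mult.assoc)

definition degree_types :: "'c multiset \<Rightarrow> 'c nzvec multiset set" where
  "degree_types d = {L. (\<Sum>n\<in>#L. vec_of n) = d}"

definition hspan :: "'c multiset \<Rightarrow> ((nat \<times> 'c) multiset, 'k::field_char_0) fseries set" where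
  "hspan d = fser.span (hprod ` degree_types d)"

text \<open>By bilinearity it suffices to multiply generators, where
  \<open>hprod L * hprod L'\<close> is \<open>hprod (L + L')\<close>; there is one span induction
  for each factor.\<close>

lemma hspan_mult:
  assumes "f \<in> hspan d" "g \<in> hspan e"
  shows "f * g \<in> hspan (d + e)"
proof -
  have scale: "sscale a f * g = sscale a (f * g)" "f * sscale a g = sscale a (f * g)"
    for a :: 'b and f g :: "((nat \<times> 'a) multiset, 'b) fseries"
    by (simp_all add: sscale_def times_fseries_def sum_distrib_left split_beta mult_ac)
  have *: "hprod L * g \<in> hspan (d + e)" if L: "L \<in> degree_types d" for L
    using assms(2)[unfolded hspan_def]
  proof (induction rule: fser.span_induct)
    case base
    show ?case
      by (rule fser.subspaceI)
        (auto simp: hspan_def scale distrib_left intro: fser.span_add fser.span_scale fser.span_zero)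
  next
    case (step g)
    then obtain L' where "L' \<in> degree_types e" "g = hprod L'" by blast
    then have "hprod L * g = hprod (L + L')" "L + L' \<in> degree_types (d + e)"
      using L by (simp_all add: hprod_def degree_types_def)
    then show ?case unfolding hspan_def by (metis fser.span_base image_eqI)
  qed
  show ?thesis
    using assms(1)[unfolded hspan_def]
  proof (induction rule: fser.span_induct)
    case base
    show ?case
      by (rule fser.subspaceI)
        (auto simp: hspan_def scale distrib_right intro: fser.span_add fser.span_scale fser.span_zero)
  qed (auto intro: *)
qed

lemma hsym_zero: "hsym {#} = 1"
proof (rule fseries_eqI)
  fix m :: "(nat \<times> 'a) multiset"
  have "sorted_words {#} = {[] :: (nat \<times> 'a) list}" by (auto simp: sorted_words_def)
  then show "scoeff (hsym {#}) m = scoeff (1 :: (_, 'b) fseries) m"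
    by (simp add: scoeff_hsym one_fseries_def)
qed

lemma hsym_in_hspan: "hsym n \<in> hspan n"
proof (cases "n = {#}")
  case True
  then have "hsym n = hprod {#}" "{#} \<in> degree_types n"
    by (simp_all add: hsym_zero hprod_def degree_types_def)
  then show ?thesis unfolding hspan_def by (metis fser.span_base image_eqI)
next
  case False
  then have "vec_of (Abs_nzvec n) = n" by (simp add: Abs_nzvec_inverse)
  then have "hsym n = hprod {#Abs_nzvec n#}" "{#Abs_nzvec n#} \<in> degree_types n"
    by (simp_all add: hprod_def degree_types_def)
  then show ?thesis unfolding hspan_def by (metis fser.span_base image_eqI)
qed

text \<open>In Newton's identity the summand with first part \<open>{#}\<close> is
  \<open>qsym n\<close> itself, and all the others involve \<open>qsym\<close> of smaller size.
  Solving for it gives the induction.\<close>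

lemma qsym_in_hspan: "qsym n \<in> hspan n"
proof (induction n rule: measure_induct_rule[where f = size])
  case (less n)
  let ?D = "{(a, b). a + b = n}"
  have "sscale (of_nat (size n)) (hsym n) = qsym n + (\<Sum>p\<in>?D - {({#}, n)}. hsym (fst p) * (qsym (snd p) :: (_, 'b) fseries))"
    unfolding newton_identity by (subst sum.remove[of _ "({#}, n)"]) (auto simp: finite_decomp hsym_zero)
  then have "qsym n = sscale (of_nat (size n)) (hsym n) - (\<Sum>p\<in>?D - {({#}, n)}. hsym (fst p) * (qsym (snd p) :: (_, 'b) fseries))"
    by simp
  moreover have "hsym (fst p) * qsym (snd p) \<in> (hspan n :: (_, 'b) fseries set)" if p: "p \<in> ?D - {({#}, n)}" for p
  proof -
    have n: "n = fst p + snd p" and "fst p \<noteq> {#}" using p by auto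
    then have "size (snd p) < size n" by (simp add: nonempty_has_size[symmetric])
    then have "qsym (snd p) \<in> (hspan (snd p) :: (_, 'b) fseries set)" by (rule less)
    then show ?thesis unfolding n by (intro hspan_mult hsym_in_hspan)
  qed
  then have "(\<Sum>p\<in>?D - {({#}, n)}. hsym (fst p) * (qsym (snd p) :: (_, 'b) fseries)) \<in> hspan n"
    unfolding hspan_def by (intro fser.span_sum) auto
  moreover have "hsym n \<in> (hspan n :: (_, 'b) fseries set)" by (rule hsym_in_hspan)
  ultimately show ?case
    unfolding hspan_def by (simp add: fser.span_diff fser.span_scale)
qed

section \<open>Triangularity of the products of power sums\<close>

definition qprod :: "'c nzvec multiset \<Rightarrow> ((nat \<times> 'c) multiset, 'k::field_char_0) fseries" where
  "qprod L = (\<Prod>n\<in>#L. qsym (vec_of n))"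

lemma qprod_in_hspan: "qprod L \<in> hspan (\<Sum>n\<in>#L. vec_of n)"
proof (induction L)
  case empty
  show ?case using hsym_in_hspan[of "{#}"] by (simp add: qprod_def hsym_zero)
next
  case (add n L)
  then show ?case using hspan_mult[OF qsym_in_hspan[of "vec_of n"] add] by (simp add: qprod_def)
qed

lemma place_Cons: "place (j # js) (Word (n # ns)) = image_mset (Pair j) (vec_of n) + place js (Word ns)"
  unfolding place_def fmon.sel list.size add.right_neutral One_nat_def add_Suc_right
  by (subst sum.lessThan_Suc_shift) simp

text \<open>This form without indices shows that only the multiset of pairs (position, part)
  matters.\<close>

lemma place_conv_zip:
  "length js = length ns \<Longrightarrow>
    place js (Word ns) = (\<Sum>p\<in>#mset (zip js ns). image_mset (Pair (fst p)) (vec_of (snd p)))"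
proof (induction js ns rule: list_induct2)
  case Nil
  show ?case by (simp add: place_def)
next
  case (Cons j js n ns)
  then show ?case by (simp add: place_Cons)
qed

lemma blocks_nonempty_iff:
  "blocks m \<noteq> {} \<longleftrightarrow> m \<noteq> {#} \<and> (\<exists>j. m = image_mset (Pair j) (image_mset snd m))"
proof
  assume "blocks m \<noteq> {}"
  then obtain w j where w: "mset w = m" "w \<noteq> []" "\<forall>x\<in>set w. fst x = j" by (auto simp: blocks_def)
  have "image_mset (Pair j) (image_mset snd m) = image_mset (\<lambda>x. x) m"
    unfolding multiset.map_comp by (rule image_mset_cong) (use w in fastforce)
  then have "m = image_mset (Pair j) (image_mset snd m)" by simp
  moreover have "m \<noteq> {#}" using w by auto
  ultimately show "m \<noteq> {#} \<and> (\<exists>j. m = image_mset (Pair j) (image_mset snd m))" by blast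
next
  assume m: "m \<noteq> {#} \<and> (\<exists>j. m = image_mset (Pair j) (image_mset snd m))"
  then obtain j where j: "m = image_mset (Pair j) (image_mset snd m)" by blast
  obtain w where w: "mset w = m" using ex_mset by blast
  have "\<forall>x\<in>set w. fst x = j" unfolding set_mset_mset[symmetric] w by (subst j) auto
  then have "w \<in> blocks m" using m w by (auto simp: blocks_def)
  then show "blocks m \<noteq> {}" by blast
qed

text \<open>Each factor puts its whole part at one freely chosen position, and positions may
  coincide. All contributions are natural numbers, so nothing cancels and the support is exactly the
  set of these placements.\<close>

lemma scoeff_qprod:
  fixes ns :: "'a nzvec list"
  shows "\<exists>k :: nat. scoeff (qprod (mset ns) :: (_, 'k::field_char_0) fseries) m = of_nat k \<and>
     (k \<noteq> 0 \<longleftrightarrow> (\<exists>js. length js = length ns \<and> m = place js (Word ns)))"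
proof (induction ns arbitrary: m)
  case Nil
  show ?case by (rule exI[of _ "if m = {#} then 1 else 0"]) (simp add: qprod_def one_fseries_def place_def)
next
  case (Cons n ns)
  obtain K where K: "\<And>m. scoeff (qprod (mset ns) :: (_, 'k) fseries) m = of_nat (K m)"
    and K0: "\<And>m. K m \<noteq> 0 \<longleftrightarrow> (\<exists>js. length js = length ns \<and> m = place js (Word ns))"
    using Cons by metis
  define q where "q = (\<lambda>m :: (nat \<times> 'a) multiset. if image_mset snd m = vec_of n then card (blocks m) else 0)"
  have q0: "q a \<noteq> 0 \<longleftrightarrow> (\<exists>j. a = image_mset (Pair j) (vec_of n))" for a :: "(nat \<times> 'a) multiset"
  proof -
    have "finite (blocks a)" by (simp add: blocks_def finite_mset_lists)
    then have iff: "q a \<noteq> 0 \<longleftrightarrow> image_mset snd a = vec_of n \<and> a \<noteq> {#} \<and> (\<exists>j. a = image_mset (Pair j) (image_mset snd a))"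
      by (simp add: q_def card_gt_0_iff blocks_nonempty_iff)
    show ?thesis
    proof
      assume "\<exists>j. a = image_mset (Pair j) (vec_of n)"
      then obtain j where j: "a = image_mset (Pair j) (vec_of n)" by blast
      then have "image_mset snd a = vec_of n" by (simp add: multiset.map_comp comp_def)
      moreover have "a \<noteq> {#}" using j vec_of_ne[of n] by simp
      ultimately show "q a \<noteq> 0" using j iff by metis
    qed (use iff in metis)
  qed
  let ?k = "\<Sum>p\<in>{(a, b). a + b = m}. q (fst p) * K (snd p)"
  have "qprod (mset (n # ns)) = qsym (vec_of n) * (qprod (mset ns) :: (_, 'k) fseries)"
    by (simp add: qprod_def)
  moreover have "scoeff (qsym (vec_of n)) a = (of_nat (q a) :: 'k)" for a
    by (simp add: qsym_def q_def)
  ultimately have "scoeff (qprod (mset (n # ns)) :: (_, 'k) fseries) m = of_nat ?k"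
    by (simp add: times_fseries_def split_beta K)
  moreover have "?k \<noteq> 0 \<longleftrightarrow> (\<exists>a b. m = a + b \<and> q a \<noteq> 0 \<and> K b \<noteq> 0)"
    by (subst sum_eq_0_iff) (auto simp: finite_decomp)
  moreover have "\<dots> \<longleftrightarrow> (\<exists>js. length js = length (n # ns) \<and> m = place js (Word (n # ns)))"
    unfolding q0 K0 by (force simp: place_Cons length_Suc_conv)
  ultimately show ?case by blast
qed

text \<open>The leading monomial of \<open>ns'\<close> occupies \<open>length ns'\<close> positions,
  and each part of \<open>ns\<close> occupies only one. With at most as many parts in
  \<open>ns\<close>, none can share a position, so \<open>js\<close> permutes the positions and the
  parts match.\<close>

lemma place_eq_leading_imp_mset_eq:
  assumes js: "length js = length ns" and eq: "place js (Word ns) = leading (Word ns')"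
    and le: "length ns \<le> length ns'"
  shows "mset ns = mset ns'"
proof -
  let ?r = "length ns'"
  have "set js = {..<?r}"
    using fst_place[of js "Word ns"] fst_place[of "[0..<?r]" "Word ns'"] js eq by (simp add: atLeast0LessThan)
  then have "distinct js" and "length js = ?r"
    using le js by (metis card_lessThan card_distinct card_length le_antisym)+
  have m: "mset js = mset [0..<?r]"
    by (rule iffD1[OF set_eq_iff_mset_eq_distinct])
      (simp_all add: \<open>distinct js\<close> \<open>set js = _\<close> lessThan_atLeast0)
  \<comment> \<open>The parts of \<open>ns'\<close> read in the order \<open>js\<close>. Placed at
    \<open>js\<close> they give the leading monomial again, hence they coincide with
    \<open>ns\<close> by \<open>place_inject\<close>.\<close>
  let ?ns = "map ((!) ns') js"
  have pl: "place is (Word (map ((!) ns') is)) = (\<Sum>i\<in>#mset is. image_mset (Pair i) (vec_of (ns' ! i)))" for "is"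
    by (subst place_conv_zip) (simp_all add: zip_map2 zip_same_conv_map image_mset.compositionality comp_def flip: mset_map)
  have "place js (Word ?ns) = place js (Word ns)"
    using pl[of js] pl[of "[0..<?r]"] m eq by (simp add: map_nth)
  then have "Word ?ns = Word ns"
    using js \<open>length js = ?r\<close> \<open>distinct js\<close> by (intro place_inject) simp_all
  then have "ns = ?ns" by simp
  then have "mset ns = image_mset ((!) ns') (mset js)" by (metis mset_map)
  also have "\<dots> = mset ns'" unfolding m mset_map[symmetric] map_nth ..
  finally show ?thesis .
qed

text \<open>Among the types with nonzero coefficient, take one with the most parts. Its leading
  monomial occurs in none of the other products, by triangularity.\<close>

lemma qprod_independent:
  assumes "finite A" and sum: "(\<Sum>L\<in>A. sscale (c L) (qprod L)) = (0 :: (_, 'k::field_char_0) fseries)" and "L \<in> A"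
  shows "c L = 0"
proof (rule ccontr)
  assume "c L \<noteq> 0"
  define B where "B = {L \<in> A. c L \<noteq> 0}"
  have B: "finite B" "B \<noteq> {}" using assms \<open>c L \<noteq> 0\<close> by (auto simp: B_def)
  have "Max (size ` B) \<in> size ` B" using B by (intro Max_in) auto
  then obtain M where M: "M \<in> B" and "Max (size ` B) = size M" by blast
  then have max: "size L \<le> size M" if "L \<in> B" for L
    using B(1) that by (metis Max_ge finite_imageI imageI)
  obtain ns where ns: "mset ns = M" using ex_mset by blast
  let ?m = "leading (Word ns)"
  have 0: "scoeff (qprod L :: (_, 'k) fseries) ?m = 0" if "L \<in> B" "L \<noteq> M" for L
  proof (rule ccontr)
    assume ne: "\<not> ?thesis"
    obtain ns' where ns': "mset ns' = L" using ex_mset by blast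
    with ne scoeff_qprod[of ns' ?m, where 'k = 'k] obtain js where js: "length js = length ns'" "?m = place js (Word ns')"
      by (metis of_nat_0)
    have "length ns' \<le> length ns" using max[OF that(1)] ns ns' by auto
    then have "mset ns' = mset ns" using js by (intro place_eq_leading_imp_mset_eq) auto
    with that ns ns' show False by simp
  qed
  \<comment> \<open>The coefficient is a nonzero natural number, and characteristic 0 keeps it
    nonzero in the field.\<close>
  have 1: "scoeff (qprod M :: (_, 'k) fseries) ?m \<noteq> 0"
  proof -
    obtain k where k: "scoeff (qprod (mset ns) :: (_, 'k) fseries) ?m = of_nat k"
      "k \<noteq> 0 \<longleftrightarrow> (\<exists>js. length js = length ns \<and> ?m = place js (Word ns))"
      using scoeff_qprod[of ns ?m, where 'k = 'k] by blast
    have "k \<noteq> 0" unfolding k(2) by (rule exI[of _ "[0..<length ns]"]) simp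
    then show ?thesis using k ns by simp
  qed
  have "0 = (\<Sum>L\<in>A. c L * scoeff (qprod L :: (_, 'k) fseries) ?m)"
    using arg_cong[OF sum, of "\<lambda>f. scoeff f ?m"] by (simp add: scoeff_sum sscale_def zero_fseries_def)
  also have "\<dots> = (\<Sum>L\<in>{M}. c L * scoeff (qprod L :: (_, 'k) fseries) ?m)"
    using M 0 assms(1) by (intro sum.mono_neutral_right) (auto simp: B_def)
  finally show False using 1 M by (simp add: B_def)
qed

section \<open>Algebraic independence\<close>

text \<open>The independent family \<open>g\<close> has \<open>card A\<close> members in the span of
  the family \<open>f\<close>. A relation with \<open>c k\<close> nonzero would let fewer than
  \<open>card A\<close> of the vectors \<open>f\<close> span the same space.\<close>

lemma (in vector_space) family_independent_by_dimension:
  assumes fin: "finite A"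
    and indep: "\<And>c. (\<Sum>i\<in>A. c i *s g i) = 0 \<Longrightarrow> \<forall>i\<in>A. c i = 0"
    and span: "\<And>i. i \<in> A \<Longrightarrow> g i \<in> span (f ` A)"
    and sum: "(\<Sum>i\<in>A. c i *s f i) = 0" and k: "k \<in> A"
  shows "c k = 0"
proof (rule ccontr)
  assume ck: "c k \<noteq> 0"
  \<comment> \<open>The dimension bound concerns sets, so repetitions must be excluded: equal
    members would satisfy the relation with coefficients 1 and -1.\<close>
  have inj: "inj_on g A"
  proof (rule inj_onI, rule ccontr)
    fix i j assume ij: "i \<in> A" "j \<in> A" "g i = g j" "i \<noteq> j"
    let ?c = "\<lambda>l. if l = i then 1 else if l = j then -1 else 0"
    have "(\<Sum>l\<in>A. ?c l *s g l) = (\<Sum>l\<in>{i, j}. ?c l *s g l)"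
      using ij fin by (intro sum.mono_neutral_right) auto
    also have "\<dots> = 0" using ij by simp
    finally show False using indep[of ?c] ij(1) by force
  qed
  have "independent (g ` A)"
  proof
    assume "dependent (g ` A)"
    then obtain u where u: "\<exists>v\<in>g ` A. u v \<noteq> 0" "(\<Sum>v\<in>g ` A. u v *s v) = 0"
      using fin by (auto simp: dependent_finite)
    then have "(\<Sum>i\<in>A. u (g i) *s g i) = 0" using inj by (simp add: sum.reindex)
    then show False using indep[of "\<lambda>i. u (g i)"] u(1) by blast
  qed
  have "c k *s f k = - (\<Sum>i\<in>A - {k}. c i *s f i)"
    using sum sum.remove[OF fin k, of "\<lambda>i. c i *s f i"] by (simp add: eq_neg_iff_add_eq_0)
  also have "\<dots> \<in> span (f ` (A - {k}))"
    by (intro span_neg span_sum span_scale span_base) auto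
  finally have "(1 / c k) *s (c k *s f k) \<in> span (f ` (A - {k}))" by (rule span_scale)
  then have fk: "f k \<in> span (f ` (A - {k}))" using ck by simp
  have "f ` A \<subseteq> span (f ` (A - {k}))"
    using fk by (auto intro: span_base)
  then have "span (f ` A) \<subseteq> span (f ` (A - {k}))"
    by (rule span_minimal) (rule subspace_span)
  then have "card (g ` A) \<le> card (f ` (A - {k}))"
    using span fin by (intro independent_span_bound[THEN conjunct2] \<open>independent (g ` A)\<close>) auto
  also have "\<dots> \<le> card (A - {k})" using fin by (intro card_image_le) simp
  also have "\<dots> < card A" using fin k by (intro psubset_card_mono) auto
  finally show False using inj by (simp add: card_image)
qed

text \<open>Every part is a nonzero subvector of \<open>d\<close>, so the parts come from a finite
  supply and there are at most \<open>size d\<close> of them.\<close>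

lemma finite_degree_types: "finite (degree_types d)"
proof -
  define V where "V = {v. vec_of v \<subseteq># d}"
  have "finite {(a, b). a + b = d}" by (rule finite_decomp)
  then have "finite (fst ` {(a, b). a + b = d})" by simp
  moreover have "vec_of ` V \<subseteq> fst ` {(a, b). a + b = d}"
    by (force simp: V_def subset_mset.le_iff_add)
  ultimately have "finite (vec_of ` V)" by (rule finite_subset[rotated])
  then have V: "finite V" by (rule finite_imageD) (simp add: inj_on_def vec_of_inject)
  have "degree_types d \<subseteq> mset ` {ns. set ns \<subseteq> V \<and> length ns \<le> size d}"
  proof
    fix L assume L: "L \<in> degree_types d"
    obtain ns where ns: "mset ns = L" using ex_mset by blast
    have "set ns \<subseteq> V"
    proof
      fix n assume "n \<in> set ns"
      then have "n \<in># L" using ns by auto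
      then obtain L' where "L = add_mset n L'" by (blast dest: multi_member_split)
      then have "d = vec_of n + (\<Sum>n\<in>#L'. vec_of n)" using L by (simp add: degree_types_def)
      then show "n \<in> V" by (simp add: V_def)
    qed
    moreover have "length ns \<le> size (\<Sum>n\<in>#mset ns. vec_of n)"
    proof (induction ns)
      case (Cons n ns)
      then show ?case using vec_of_ne[of n] by (simp add: nonempty_has_size Suc_le_eq)
    qed simp
    ultimately show "L \<in> mset ` {ns. set ns \<subseteq> V \<and> length ns \<le> size d}"
      using L ns by (auto simp: degree_types_def)
  qed
  then show ?thesis by (rule finite_subset) (use V in \<open>simp add: finite_lists_length_le\<close>)
qed

lemma scoeff_hprod_eq_0:
  "image_mset snd m \<noteq> (\<Sum>n\<in>#L. vec_of n) \<Longrightarrow> scoeff (hprod L :: (_, 'k::field_char_0) fseries) m = 0"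
proof (induction L arbitrary: m)
  case empty
  then show ?case by (auto simp: hprod_def one_fseries_def)
next
  case (add n L)
  have "scoeff (hsym (vec_of n) :: (_, 'k) fseries) a * scoeff (hprod L) b = 0" if "m = a + b" for a b
    using add that by (cases "image_mset snd a = vec_of n") (auto simp: scoeff_hsym)
  then show ?case by (auto simp: hprod_def times_fseries_def intro!: sum.neutral)
qed

text \<open>Homogeneity isolates the part of the relation in the multidegree of \<open>L\<close>.
  There the products of power sums are independent, lie in the span of the \<open>hprod\<close>, and
  have the same finite index set, so the dimension argument applies.\<close>

lemma hprod_independent:
  assumes A: "finite A" and sum: "(\<Sum>L\<in>A. sscale (c L) (hprod L)) = (0 :: (_, 'k::field_char_0) fseries)" and L: "L \<in> A"
  shows "c L = 0"
proof -
  define d where "d = (\<Sum>n\<in>#L. vec_of n)"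
  \<comment> \<open>The dimension argument needs a relation over all types of degree
    \<open>d\<close>, so the coefficients are extended by 0 outside \<open>A\<close>.\<close>
  define c' where "c' = (\<lambda>L. if L \<in> A then c L else 0)"
  have LD: "L \<in> degree_types d" by (simp add: degree_types_def d_def)
  have "(\<Sum>L\<in>degree_types d. sscale (c' L) (hprod L)) = (0 :: (_, 'k) fseries)"
  proof (rule fseries_eqI)
    fix m
    show "scoeff (\<Sum>L\<in>degree_types d. sscale (c' L) (hprod L)) m = scoeff (0 :: (_, 'k) fseries) m"
    proof (cases "image_mset snd m = d")
      case True
      have "scoeff (\<Sum>L\<in>degree_types d. sscale (c' L) (hprod L)) m =
          (\<Sum>L\<in>A \<inter> degree_types d. c L * scoeff (hprod L :: (_, 'k) fseries) m)"
        unfolding scoeff_sum sscale_def fseries.sel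
        by (rule sum.mono_neutral_cong_right) (auto simp: finite_degree_types c'_def)
      also have "\<dots> = (\<Sum>L\<in>A. c L * scoeff (hprod L :: (_, 'k) fseries) m)"
      proof (rule sum.mono_neutral_left)
        have "scoeff (hprod L :: (_, 'k) fseries) m = 0" if "L \<notin> degree_types d" for L
          by (rule scoeff_hprod_eq_0) (use True that in \<open>auto simp: degree_types_def\<close>)
        then show "\<forall>L\<in>A - A \<inter> degree_types d. c L * scoeff (hprod L :: (_, 'k) fseries) m = 0" by simp
      qed (use A in auto)
      also have "\<dots> = scoeff (0 :: (_, 'k) fseries) m"
        unfolding sum[symmetric] by (simp add: scoeff_sum sscale_def)
      finally show ?thesis .
    next
      case False
      then show ?thesis
        by (auto simp: scoeff_sum sscale_def zero_fseries_def degree_types_def scoeff_hprod_eq_0 intro!: sum.neutral)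
    qed
  qed
  then have "c' L = 0"
  proof (rule fser.family_independent_by_dimension[OF finite_degree_types _ _ _ LD, rotated 2])
    show "\<forall>L\<in>degree_types d. c L = 0" if "(\<Sum>L\<in>degree_types d. sscale (c L) (qprod L)) = (0 :: (_, 'k) fseries)" for c
      using qprod_independent[OF finite_degree_types that] by blast
    show "qprod L \<in> fser.span (hprod ` degree_types d)" if "L \<in> degree_types d" for L
      using qprod_in_hspan[of L] that by (auto simp: hspan_def degree_types_def)
  qed
  then show ?thesis using L by (simp add: c'_def)
qed

section \<open>Coordinates of commutative images\<close>

definition type_coeff :: "('c, 'k::field_char_0) ncsym \<Rightarrow> 'c nzvec multiset \<Rightarrow> 'k" where
  "type_coeff F L = (\<Sum>I | mset (letters I) = L. Poly_Mapping.lookup F I)"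

lemma comm_image_conv_type_coeff:
  assumes "finite A" "(\<lambda>I. mset (letters I)) ` Poly_Mapping.keys F \<subseteq> A"
  shows "comm_image F = (\<Sum>L\<in>A. sscale (type_coeff F L) (hprod L))"
proof -
  let ?X = "SIGMA L:A. {I. mset (letters I) = L}"
  have fin: "finite ?X" using assms(1) finite_words_mset by (intro finite_SigmaI) auto
  then have "finite (snd ` ?X)" by simp
  then have "comm_image F = (\<Sum>I\<in>snd ` ?X. sscale (Poly_Mapping.lookup F I) (hprod (mset (letters I))))"
    by (rule comm_image_eq) (use assms(2) in force)
  also have "\<dots> = (\<Sum>p\<in>?X. sscale (Poly_Mapping.lookup F (snd p)) (hprod (fst p)))"
    by (rule sum.reindex_cong[where l = snd]) (auto simp: inj_on_def)
  also have "\<dots> = (\<Sum>(L, I)\<in>?X. sscale (Poly_Mapping.lookup F I) (hprod L))"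
    by (rule sum.cong) auto
  also have "\<dots> = (\<Sum>L\<in>A. \<Sum>I | mset (letters I) = L. sscale (Poly_Mapping.lookup F I) (hprod L))"
    using assms(1) by (intro sum.Sigma[symmetric]) (simp_all add: finite_words_mset)
  also have "\<dots> = (\<Sum>L\<in>A. sscale (type_coeff F L) (hprod L))"
    by (simp only: type_coeff_def fser.scale_sum_left)
  finally show ?thesis .
qed

text \<open>The type coefficients are the coordinates along the independent family
  \<open>hprod\<close>, and both vanish on types that occur in neither support.\<close>

lemma comm_image_eq_iff: "comm_image F = comm_image G \<longleftrightarrow> type_coeff F = type_coeff G"
proof -
  let ?A = "(\<lambda>I. mset (letters I)) ` (Poly_Mapping.keys F \<union> Poly_Mapping.keys G)"
  have A: "finite ?A" by simp
  have eq: "comm_image F = (\<Sum>L\<in>?A. sscale (type_coeff F L) (hprod L))"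
       "comm_image G = (\<Sum>L\<in>?A. sscale (type_coeff G L) (hprod L))"
    by (rule comm_image_conv_type_coeff; force)+
  show ?thesis
  proof
    assume "comm_image F = comm_image G"
    then have "(\<Sum>L\<in>?A. sscale (type_coeff F L - type_coeff G L) (hprod L)) = (0 :: (_, 'b) fseries)"
      unfolding eq by (simp add: fser.scale_left_diff_distrib sum_subtractf)
    then have "type_coeff F L - type_coeff G L = 0" if "L \<in> ?A" for L
      by (rule hprod_independent[OF A _ that])
    moreover have "type_coeff F L - type_coeff G L = 0" if "L \<notin> ?A" for L
    proof -
      have "\<forall>I. mset (letters I) = L \<longrightarrow> Poly_Mapping.lookup F I = 0 \<and> Poly_Mapping.lookup G I = 0"
        using that by (auto simp: in_keys_iff)
      then show ?thesis by (simp add: type_coeff_def)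
    qed
    ultimately have "type_coeff F L - type_coeff G L = 0" for L by blast
    then show "type_coeff F = type_coeff G" by (intro ext) simp
  qed (simp add: eq)
qed

section \<open>Symmetry of the coproduct\<close>

definition move :: "('p \<Rightarrow> 'q) \<Rightarrow> ('p \<times> 'c) multiset \<Rightarrow> ('q \<times> 'c) multiset" where
  "move \<sigma> = image_mset (\<lambda>x. (\<sigma> (fst x), snd x))"

definition move2 where "move2 \<sigma> \<tau> m = (move \<sigma> (fst m), move \<tau> (snd m))"

lemma inj_move: "inj \<sigma> \<Longrightarrow> inj (move \<sigma>)"
  unfolding move_def by (rule multiset.inj_map) (auto simp: inj_def prod_eq_iff)

lemma inj_move2: "inj \<sigma> \<Longrightarrow> inj \<tau> \<Longrightarrow> inj (move2 \<sigma> \<tau>)"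
  using inj_move[of \<sigma>] inj_move[of \<tau>] by (auto simp: inj_def move2_def prod_eq_iff)

lemma move2_add: "move2 \<sigma> \<tau> (a + b) = move2 \<sigma> \<tau> a + move2 \<sigma> \<tau> b"
  by (simp add: move2_def move_def prod_eq_iff)

lemma move2_eq_plusD:
  assumes "move2 \<sigma> \<tau> m = a + b"
  obtains a' b' where "m = a' + b'" "a = move2 \<sigma> \<tau> a'" "b = move2 \<sigma> \<tau> b'"
proof -
  have "move \<sigma> (fst m) = fst a + fst b" "move \<tau> (snd m) = snd a + snd b"
    using assms by (simp_all add: move2_def prod_eq_iff)
  then obtain a1 b1 a2 b2 where
    "fst m = a1 + b1" "fst a = move \<sigma> a1" "fst b = move \<sigma> b1"
    "snd m = a2 + b2" "snd a = move \<tau> a2" "snd b = move \<tau> b2"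
    unfolding move_def by (meson image_mset_eq_plusD)
  then have "m = (a1, a2) + (b1, b2)" "a = move2 \<sigma> \<tau> (a1, a2)" "b = move2 \<sigma> \<tau> (b1, b2)"
    by (simp_all add: move2_def prod_eq_iff)
  then show thesis by (rule that)
qed

text \<open>A pullback of coefficients. For injective maps it undoes the renaming of rows by
  \<sigma> and of columns by \<tau>, and sends variables outside the ranges to 0.\<close>

definition relabel :: "(nat \<Rightarrow> nat) \<Rightarrow> (nat \<Rightarrow> nat) \<Rightarrow> ('c, 'k::field_char_0) biseries \<Rightarrow> ('c, 'k) biseries" where
  "relabel \<sigma> \<tau> f = FSeries (\<lambda>m. scoeff f (move2 \<sigma> \<tau> m))"

text \<open>Each factorization of a moved monomial is the image of exactly one factorization of the
  original: existence is \<open>move2_eq_plusD\<close>, uniqueness is injectivity.\<close>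

lemma relabel_mult:
  assumes "inj \<sigma>" "inj \<tau>"
  shows "relabel \<sigma> \<tau> (f * g) = relabel \<sigma> \<tau> f * relabel \<sigma> \<tau> g"
proof (rule fseries_eqI)
  fix m
  let ?L = "move2 \<sigma> \<tau>"
  have "(\<Sum>(a, b) | a + b = ?L m. scoeff f a * scoeff g b) =
      (\<Sum>(a, b) | a + b = m. scoeff f (?L a) * scoeff g (?L b))"
  proof (rule sum.reindex_cong[where l = "\<lambda>(a, b). (?L a, ?L b)"])
    show "inj_on (\<lambda>(a, b). (?L a, ?L b)) {(a, b). a + b = m}"
      using inj_move2[OF assms] by (auto simp: inj_on_def dest: injD)
    show "{(a, b). a + b = ?L m} = (\<lambda>(a, b). (?L a, ?L b)) ` {(a, b). a + b = m}"
    proof (intro equalityI subsetI)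
      fix p assume "p \<in> {(a, b). a + b = ?L m}"
      then obtain a b where p: "p = (a, b)" "?L m = a + b" by auto
      from move2_eq_plusD[OF p(2)] obtain a' b' where "m = a' + b'" "a = ?L a'" "b = ?L b'" .
      then show "p \<in> (\<lambda>(a, b). (?L a, ?L b)) ` {(a, b). a + b = m}" using p by auto
    next
      fix p assume "p \<in> (\<lambda>(a, b). (?L a, ?L b)) ` {(a, b). a + b = m}"
      then obtain a b where "p = (?L a, ?L b)" "a + b = m" by auto
      then show "p \<in> {(a, b). a + b = ?L m}" by (auto simp: move2_add)
    qed
  qed auto
  then show "scoeff (relabel \<sigma> \<tau> (f * g)) m = scoeff (relabel \<sigma> \<tau> f * relabel \<sigma> \<tau> g) m"
    by (simp add: relabel_def times_fseries_def)
qed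

lemma relabel_one: "relabel \<sigma> \<tau> 1 = 1"
  by (rule fseries_eqI) (auto simp: relabel_def one_fseries_def move2_def move_def zero_prod_def prod_eq_iff)

lemma relabel_prod_mset:
  "inj \<sigma> \<Longrightarrow> inj \<tau> \<Longrightarrow> relabel \<sigma> \<tau> (\<Prod>i\<in>#A. f i) = (\<Prod>i\<in>#A. relabel \<sigma> \<tau> (f i))"
  by (induction A) (simp_all add: relabel_one relabel_mult)

lemma varXY_eq: "varXY p c = (\<Sum>(a, b) | a + b = c. smonom ({#(fst p, a)#}, {#(snd p, b)#}))"
  unfolding varXY_def varX_def varY_def smonom_mult by simp

lemma relabel_varXY:
  assumes "inj \<sigma>" "inj \<tau>"
  shows "relabel \<sigma> \<tau> (varXY (map_prod \<sigma> \<tau> p) c) = varXY p c"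
proof (rule fseries_eqI)
  fix m :: "(nat \<times> 'a) multiset \<times> (nat \<times> 'a) multiset"
  have "(move2 \<sigma> \<tau> m = ({#(\<sigma> r, a)#}, {#(\<tau> s, b)#})) = (m = ({#(r, a)#}, {#(s, b)#}))" for r s a b
  proof -
    have "({#(\<sigma> r, a)#}, {#(\<tau> s, b)#}) = move2 \<sigma> \<tau> ({#(r, a)#}, {#(s, b)#})"
      by (simp add: move2_def move_def)
    then show ?thesis by (simp only: inj_eq[OF inj_move2[OF assms]])
  qed
  then show "scoeff (relabel \<sigma> \<tau> (varXY (map_prod \<sigma> \<tau> p) c)) m = scoeff (varXY p c) m"
    by (simp add: relabel_def varXY_eq scoeff_sum smonom_def split_beta)
qed

section \<open>Monomials in the variables of the product alphabet\<close>

text \<open>One summand of \<delta>(\<open>M_K\<close>), with parts attached to cells (row, column).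
  Passing to \<open>mset zs\<close> makes visible that the order of the cells does not affect
  it.\<close>

definition placed_prod :: "((nat \<times> nat) \<times> 'c::{ab_semigroup_add, finite_decomp} nzvec) list \<Rightarrow> ('c, 'k::field_char_0) biseries" where
  "placed_prod zs = (\<Prod>z\<in>#mset zs. \<Prod>c\<in>#vec_of (snd z). varXY (fst z) c)"

lemma scoeff_placed_prod_map:
  assumes "inj \<sigma>" "inj \<tau>"
  shows "scoeff (placed_prod (map (map_prod (map_prod \<sigma> \<tau>) id) zs)) (move2 \<sigma> \<tau> m) =
    scoeff (placed_prod zs :: ('c::{ab_semigroup_add, finite_decomp}, 'k::field_char_0) biseries) m"
proof -
  have "relabel \<sigma> \<tau> (placed_prod (map (map_prod (map_prod \<sigma> \<tau>) id) zs)) = (placed_prod zs :: ('c, 'k) biseries)"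
    by (simp add: placed_prod_def multiset.map_comp comp_def relabel_prod_mset relabel_varXY assms)
  then show ?thesis by (metis relabel_def fseries.sel)
qed

text \<open>A monomial of a product of variables \<open>t\<close> arises by splitting the color of each factor.\<close>

definition splits_of :: "((nat \<times> nat) \<times> 'c::ab_semigroup_add) multiset \<Rightarrow> ('c, 'k::field_char_0) biseries \<Rightarrow> bool" where
  "splits_of W f \<longleftrightarrow> (\<forall>m. scoeff f m \<noteq> 0 \<longrightarrow> (\<exists>Z.
     m = (image_mset (\<lambda>(p, a, b). (fst p, a)) Z, image_mset (\<lambda>(p, a, b). (snd p, b)) Z) \<and>
     W = image_mset (\<lambda>(p, a, b). (p, a + b)) Z))"

lemma splits_of_one: "splits_of {#} 1"
  by (auto simp: splits_of_def one_fseries_def zero_prod_def)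

lemma splits_of_mult:
  assumes "splits_of W f" "splits_of W' g"
  shows "splits_of (W + W') (f * g)"
  unfolding splits_of_def
proof (intro allI impI)
  fix m assume "scoeff (f * g) m \<noteq> 0"
  then obtain a b where m: "m = a + b" and a: "scoeff f a \<noteq> 0" and b: "scoeff g b \<noteq> 0"
    by (auto simp: times_fseries_def elim!: sum.not_neutral_contains_not_neutral)
  obtain Z where Z: "a = (image_mset (\<lambda>(p, a, b). (fst p, a)) Z, image_mset (\<lambda>(p, a, b). (snd p, b)) Z)"
     "W = image_mset (\<lambda>(p, a, b). (p, a + b)) Z"
    using assms(1) a unfolding splits_of_def by blast
  obtain Z' where Z': "b = (image_mset (\<lambda>(p, a, b). (fst p, a)) Z', image_mset (\<lambda>(p, a, b). (snd p, b)) Z')"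
     "W' = image_mset (\<lambda>(p, a, b). (p, a + b)) Z'"
    using assms(2) b unfolding splits_of_def by blast
  show "\<exists>Z. m = (image_mset (\<lambda>(p, a, b). (fst p, a)) Z, image_mset (\<lambda>(p, a, b). (snd p, b)) Z) \<and>
     W + W' = image_mset (\<lambda>(p, a, b). (p, a + b)) Z"
    by (rule exI[of _ "Z + Z'"]) (simp add: m Z Z')
qed

lemma splits_of_varXY: "splits_of {#(p, c)#} (varXY p c)"
  unfolding splits_of_def
proof (intro allI impI)
  fix m assume "scoeff (varXY p c) m \<noteq> (0 :: 'b)"
  then obtain a b where "a + b = c" "m = ({#(fst p, a)#}, {#(snd p, b)#})"
    by (auto simp: varXY_eq scoeff_sum smonom_def split: if_splits elim!: sum.not_neutral_contains_not_neutral)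
  then show "\<exists>Z. m = (image_mset (\<lambda>(p, a, b). (fst p, a)) Z, image_mset (\<lambda>(p, a, b). (snd p, b)) Z) \<and>
     {#(p, c)#} = image_mset (\<lambda>(p, a, b). (p, a + b)) Z"
    by (intro exI[of _ "{#(p, a, b)#}"]) simp
qed

lemma splits_of_prod_mset:
  "(\<And>i. i \<in># A \<Longrightarrow> splits_of (W i) (f i)) \<Longrightarrow> splits_of (\<Sum>i\<in>#A. W i) (\<Prod>i\<in>#A. f i)"
  by (induction A) (simp_all add: splits_of_one splits_of_mult)

lemma splits_of_placed_prod:
  "splits_of (\<Sum>z\<in>#mset zs. image_mset (Pair (fst z)) (vec_of (snd z)))
    (placed_prod zs :: ('c::{ab_semigroup_add, finite_decomp}, 'k::field_char_0) biseries)"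
  unfolding placed_prod_def
proof (rule splits_of_prod_mset)
  fix z :: "(nat \<times> nat) \<times> 'c nzvec"
  have "image_mset (Pair (fst z)) n = (\<Sum>c\<in>#n. {#(fst z, c)#})" for n
    by (induction n) simp_all
  from this[of "vec_of (snd z)"] show "splits_of (image_mset (Pair (fst z)) (vec_of (snd z))) (\<Prod>c\<in>#vec_of (snd z). varXY (fst z) c :: ('c, 'k) biseries)"
    by (simp only: splits_of_prod_mset[OF splits_of_varXY])
qed

text \<open>The multiset \<open>Z\<close> of split factors projects to \<open>m1\<close> and
  \<open>m2\<close> and recombines to the colored cells. The bounds on sizes, occupied lines and
  colors read off from it give the finiteness statements below.\<close>

lemma scoeff_placed_prod_nonzeroD:
  assumes "scoeff (placed_prod zs :: ('c::{ab_semigroup_add, finite_decomp}, 'k::field_char_0) biseries) (m1, m2) \<noteq> 0"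
  shows "size m1 = (\<Sum>z\<in>#mset zs. size (vec_of (snd z)))" "size m2 = size m1"
    and "z \<in> set zs \<Longrightarrow> fst (fst z) \<in> fst ` set_mset m1 \<and> snd (fst z) \<in> fst ` set_mset m2"
    and "x \<in># m1 \<Longrightarrow> \<exists>z\<in>set zs. \<exists>c\<in>#vec_of (snd z). \<exists>b. snd x + b = c"
    and "x \<in># m2 \<Longrightarrow> \<exists>z\<in>set zs. \<exists>c\<in>#vec_of (snd z). \<exists>a. a + snd x = c"
proof -
  define W where "W = (\<Sum>z\<in>#mset zs. image_mset (Pair (fst z)) (vec_of (snd z)))"
  obtain Z where m: "m1 = image_mset (\<lambda>(p, a, b). (fst p, a)) Z" "m2 = image_mset (\<lambda>(p, a, b). (snd p, b)) Z"
    and W: "W = image_mset (\<lambda>(p, a, b). (p, a + b)) Z"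
    using splits_of_placed_prod[of zs, where 'k = 'k] assms unfolding splits_of_def W_def[symmetric] by blast
  have "size W = (\<Sum>z\<in>#mset zs. size (vec_of (snd z)))"
    by (simp add: W_def multiset.map_comp comp_def)
  then show "size m1 = (\<Sum>z\<in>#mset zs. size (vec_of (snd z)))" "size m2 = size m1"
    by (simp_all add: m W)
  show "fst (fst z) \<in> fst ` set_mset m1 \<and> snd (fst z) \<in> fst ` set_mset m2" if z: "z \<in> set zs"
  proof -
    obtain c where "c \<in># vec_of (snd z)" using vec_of_ne[of "snd z"] by blast
    then have "(fst z, c) \<in># W" using z by (auto simp: W_def)
    then obtain a b where "(fst z, a, b) \<in># Z" by (auto simp: W)
    then have "(fst (fst z), a) \<in># m1" "(snd (fst z), b) \<in># m2"
      unfolding m by (force intro: image_eqI[of _ _ "(fst z, a, b)"])+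
    then show ?thesis by force
  qed
  show "\<exists>z\<in>set zs. \<exists>c\<in>#vec_of (snd z). \<exists>b. snd x + b = c" if x: "x \<in># m1"
  proof -
    obtain p a b where "(p, a, b) \<in># Z" "x = (fst p, a)" using x by (force simp: m)
    moreover from this have "(p, a + b) \<in># W" by (force simp: W)
    ultimately show ?thesis by (auto simp: W_def)
  qed
  show "\<exists>z\<in>set zs. \<exists>c\<in>#vec_of (snd z). \<exists>a. a + snd x = c" if x: "x \<in># m2"
  proof -
    obtain p a b where "(p, a, b) \<in># Z" "x = (snd p, b)" using x by (force simp: m)
    moreover from this have "(p, a + b) \<in># W" by (force simp: W)
    ultimately show ?thesis by (auto simp: W_def)
  qed
qed

lemma lex_less_eq: "lex_less = (<)"
  by (auto simp: fun_eq_iff lex_less_def less_prod_def)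

section \<open>Symmetries of the coefficients of the coproduct\<close>

text \<open>The index sequences of \<open>M_eval\<close> with the parts attached, so that moving
  cells carries the parts along.\<close>

definition placements :: "'c vcomp \<Rightarrow> ((nat \<times> nat) \<times> 'c nzvec) list set" where
  "placements K = {zs. map snd zs = letters K \<and> sorted_wrt (<) (map fst zs)}"

lemma finite_placements:
  "finite {zs \<in> placements K. scoeff (placed_prod zs :: ('c::{ab_semigroup_add, finite_decomp}, 'k::field_char_0) biseries) m \<noteq> 0}"
    (is "finite ?S")
proof -
  obtain m1 m2 where m: "m = (m1, m2)" by force
  let ?P = "(fst ` set_mset m1) \<times> (fst ` set_mset m2)"
  have "?S \<subseteq> {zs. set zs \<subseteq> ?P \<times> set (letters K) \<and> length zs = length (letters K)}"
  proof
    fix zs assume zs: "zs \<in> ?S"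
    then have K: "map snd zs = letters K" by (simp add: placements_def)
    have "z \<in> ?P \<times> set (letters K)" if "z \<in> set zs" for z
    proof -
      have "scoeff (placed_prod zs :: ('c, 'k) biseries) (m1, m2) \<noteq> 0" using zs by (simp add: m)
      note scoeff_placed_prod_nonzeroD(3)[OF this that]
      moreover have "snd z \<in> set (letters K)" unfolding K[symmetric] using that by simp
      ultimately show ?thesis by (simp add: mem_Times_iff)
    qed
    then show "zs \<in> {zs. set zs \<subseteq> ?P \<times> set (letters K) \<and> length zs = length (letters K)}"
      using arg_cong[OF K, of length] by auto
  qed
  then show ?thesis by (rule finite_subset) (intro finite_lists_length_eq, simp)
qed

lemma scoeff_delta_M:
  "scoeff (delta_M K :: ('c::{ab_semigroup_add, finite_decomp}, 'k::field_char_0) biseries) m =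
    (\<Sum>zs | zs \<in> placements K \<and> scoeff (placed_prod zs :: ('c, 'k) biseries) m \<noteq> 0. scoeff (placed_prod zs) m)"
proof -
  define f where "f = (\<lambda>js. (\<Prod>l<length (letters K). \<Prod>c\<in>set_mset (vec_of (letters K ! l)).
        varXY (js ! l) c ^ count (vec_of (letters K ! l)) c) :: ('c, 'k) biseries)"
  have f: "f (map fst zs) = placed_prod zs" if "map snd zs = letters K" for zs
  proof -
    have len: "length (letters K) = length zs" unfolding that[symmetric] by simp
    have 1: "f (map fst zs) = (\<Prod>l<length zs. \<Prod>c\<in>#vec_of (snd (zs ! l)). varXY (fst (zs ! l)) c)"
      unfolding f_def prod_power_count len by (rule prod.cong) (simp_all flip: that)
    have "mset zs = image_mset ((!) zs) (mset_set {..<length zs})"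
      by (metis map_nth mset_map mset_upt atLeast0LessThan)
    then have "(\<Prod>l<length zs. \<Prod>c\<in>#vec_of (snd (zs ! l)). varXY (fst (zs ! l)) c) = placed_prod zs"
      by (simp add: placed_prod_def prod_unfold_prod_mset multiset.map_comp comp_def)
    with 1 show ?thesis by simp
  qed
  have zs: "map snd (zip js (letters K)) = letters K" "map fst (zip js (letters K)) = js"
    if "length js = length (letters K)" for js :: "(nat \<times> nat) list"
    using that by simp_all
  have "scoeff (delta_M K :: ('c, 'k) biseries) m =
    (\<Sum>js | (length js = length (letters K) \<and> sorted_wrt (<) js) \<and> scoeff (f js) m \<noteq> 0. scoeff (f js) m)"
    by (simp add: delta_M_def M_eval_def fsum_def f_def lex_less_eq)
  also have "\<dots> = (\<Sum>zs | zs \<in> placements K \<and> scoeff (placed_prod zs :: ('c, 'k) biseries) m \<noteq> 0. scoeff (placed_prod zs) m)"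
  proof (rule sum.reindex_bij_witness[where i = "map fst" and j = "\<lambda>js. zip js (letters K)"])
    fix js assume js: "js \<in> {js. (length js = length (letters K) \<and> sorted_wrt (<) js) \<and> scoeff (f js) m \<noteq> 0}"
    then have l: "length js = length (letters K)" by simp
    note z = zs[OF l]
    have fz: "f js = placed_prod (zip js (letters K))" using f[OF z(1)] unfolding z(2) .
    show "map fst (zip js (letters K)) = js" by (rule z)
    show "zip js (letters K) \<in> {zs. zs \<in> placements K \<and> scoeff (placed_prod zs :: ('c, 'k) biseries) m \<noteq> 0}"
      using js fz z by (simp add: placements_def)
    show "scoeff (placed_prod (zip js (letters K))) m = scoeff (f js) m" by (simp only: fz)
  next
    fix zs assume "zs \<in> {zs. zs \<in> placements K \<and> scoeff (placed_prod zs :: ('c, 'k) biseries) m \<noteq> 0}"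
    then have a: "map snd zs = letters K" "sorted_wrt (<) (map fst zs)" "scoeff (placed_prod zs :: ('c, 'k) biseries) m \<noteq> 0"
      by (simp_all add: placements_def)
    show "zip (map fst zs) (letters K) = zs" by (simp add: zip_map_fst_snd flip: a(1))
    have "length zs = length (letters K)" by (simp flip: a(1))
    then show "map fst zs \<in> {js. (length js = length (letters K) \<and> sorted_wrt (<) js) \<and> scoeff (f js) m \<noteq> 0}"
      using a f[OF a(1)] by simp
  qed
  finally show ?thesis .
qed

text \<open>Strictly increasing maps of rows and columns respect the lexicographic order of cells,
  so they act on the placements of each single \<open>K\<close>.\<close>

lemma scoeff_delta_M_quasi_symmetric:
  assumes "strict_mono \<sigma>" "strict_mono \<tau>"
  shows "scoeff (delta_M K) (move2 \<sigma> \<tau> m) = scoeff (delta_M K :: ('c::{ab_semigroup_add, finite_decomp}, 'k::field_char_0) biseries) m"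
proof -
  have inj: "inj \<sigma>" "inj \<tau>" using assms by (simp_all add: strict_mono_imp_inj_on)
  define g where "g = map (map_prod (map_prod \<sigma> \<tau>) (id :: 'c nzvec \<Rightarrow> 'c nzvec))"
  define g' where "g' = map (map_prod (map_prod (inv \<sigma>) (inv \<tau>)) (id :: 'c nzvec \<Rightarrow> 'c nzvec))"
  have g'g: "g' (g zs) = zs" for zs
    by (simp add: g_def g'_def comp_def map_prod_def split_beta inj)
  have mono: "map_prod \<sigma> \<tau> p < map_prod \<sigma> \<tau> q \<longleftrightarrow> p < q" for p q
    using assms inj by (cases p; cases q) (simp add: strict_mono_less inj_eq strict_mono_less_eq)
  have pl: "g zs \<in> placements K \<longleftrightarrow> zs \<in> placements K" for zs
    by (simp add: placements_def g_def comp_def sorted_wrt_map mono)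
  have sc: "scoeff (placed_prod (g zs)) (move2 \<sigma> \<tau> m) = scoeff (placed_prod zs :: ('c, 'k) biseries) m" for zs
    unfolding g_def by (rule scoeff_placed_prod_map[OF inj])
  \<comment> \<open>The maps need not be surjective, but a contributing placement only uses rows and
    columns occupied by the moved monomial, which lie in the ranges.\<close>
  have gg': "g (g' zs) = zs" if "scoeff (placed_prod zs :: ('c, 'k) biseries) (move2 \<sigma> \<tau> m) \<noteq> 0" for zs
  proof -
    have "map_prod (map_prod \<sigma> \<tau>) id (map_prod (map_prod (inv \<sigma>) (inv \<tau>)) id z) = z" if z: "z \<in> set zs" for z
    proof -
      have "fst (fst z) \<in> range \<sigma>" "snd (fst z) \<in> range \<tau>"
        using scoeff_placed_prod_nonzeroD(3)[OF \<open>_ \<noteq> 0\<close>[unfolded move2_def] z] by (auto simp: move_def)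
      then show ?thesis by (cases z) (auto simp: f_inv_into_f)
    qed
    then show ?thesis by (simp add: g_def g'_def map_idI)
  qed
  have sc': "scoeff (placed_prod (g' zs)) m = scoeff (placed_prod zs :: ('c, 'k) biseries) (move2 \<sigma> \<tau> m)"
    and pl': "g' zs \<in> placements K \<longleftrightarrow> zs \<in> placements K"
    if "scoeff (placed_prod zs :: ('c, 'k) biseries) (move2 \<sigma> \<tau> m) \<noteq> 0" for zs
    using sc[of "g' zs"] pl[of "g' zs"] unfolding gg'[OF that] by simp_all
  show ?thesis unfolding scoeff_delta_M
    by (rule sum.reindex_bij_witness[where i = g and j = g'])
      (simp_all add: g'g gg' pl pl' sc sc')
qed

definition type_placements :: "'c nzvec multiset \<Rightarrow> ((nat \<times> nat) \<times> 'c nzvec) list set" where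
  "type_placements L = {zs. mset (map snd zs) = L \<and> sorted_wrt (<) (map fst zs)}"

lemma sum_scoeff_delta_M:
  "(\<Sum>K | mset (letters K) = L. scoeff (delta_M K :: ('c::{ab_semigroup_add, finite_decomp}, 'k::field_char_0) biseries) m) =
    (\<Sum>zs | zs \<in> type_placements L \<and> scoeff (placed_prod zs :: ('c, 'k) biseries) m \<noteq> 0. scoeff (placed_prod zs) m)"
proof -
  let ?X = "SIGMA K:{K. mset (letters K) = L}. {zs. zs \<in> placements K \<and> scoeff (placed_prod zs :: ('c, 'k) biseries) m \<noteq> 0}"
  have "(\<Sum>K | mset (letters K) = L. scoeff (delta_M K :: ('c, 'k) biseries) m) = (\<Sum>(K, zs)\<in>?X. scoeff (placed_prod zs) m)"
    unfolding scoeff_delta_M by (rule sum.Sigma) (auto intro: finite_words_mset finite_placements)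
  also have "\<dots> = (\<Sum>zs | zs \<in> type_placements L \<and> scoeff (placed_prod zs :: ('c, 'k) biseries) m \<noteq> 0. scoeff (placed_prod zs) m)"
    by (rule sum.reindex_bij_witness[where i = "\<lambda>zs. (Word (map snd zs), zs)" and j = snd])
      (auto simp: placements_def type_placements_def fmon.expand simp flip: mset_map)
  finally show ?thesis .
qed

text \<open>Once the parts may come in any order, the lexicographic order of the cells is only a
  normal form for a set of cells carrying parts. Permutations of rows and columns act on such
  sets.\<close>

lemma sum_scoeff_delta_M_symmetric:
  assumes "bij \<sigma>" "bij \<tau>"
  shows "(\<Sum>K | mset (letters K) = L. scoeff (delta_M K) (move2 \<sigma> \<tau> m)) =
    (\<Sum>K | mset (letters K) = L. scoeff (delta_M K :: ('c::{ab_semigroup_add, finite_decomp}, 'k::field_char_0) biseries) m)"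
proof -
  \<comment> \<open>After moving the cells, sorting restores the normal form; it may reorder the
    parts, hence change \<open>K\<close> but not its type.\<close>
  define g where "g = (\<lambda>(\<sigma> :: nat \<Rightarrow> nat) (\<tau> :: nat \<Rightarrow> nat) (zs :: ((nat \<times> nat) \<times> 'c nzvec) list). sort_key fst (map (map_prod (map_prod \<sigma> \<tau>) id) zs))"
  have inj: "inj \<sigma>" "inj \<tau>" using assms by (simp_all add: bij_is_inj)
  have dist: "distinct (map fst (map (map_prod (map_prod \<sigma> \<tau>) id) zs))"
    if "distinct (map fst zs)" "inj \<sigma>" "inj \<tau>" for \<sigma> \<tau> :: "nat \<Rightarrow> nat" and zs :: "((nat \<times> nat) \<times> 'c nzvec) list"
  proof -
    have eq: "map fst (map (map_prod (map_prod \<sigma> \<tau>) id) zs) = map (map_prod \<sigma> \<tau>) (map fst zs)" by simp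
    have "inj (map_prod \<sigma> \<tau>)" using that(2,3) by (rule prod.inj_map)
    then have "inj_on (map_prod \<sigma> \<tau>) (set (map fst zs))" by (rule inj_on_subset) (rule subset_UNIV)
    then show ?thesis using that(1) unfolding eq distinct_map[of "map_prod \<sigma> \<tau>"] by (rule conjI[rotated])
  qed
  have tp: "g \<sigma> \<tau> zs \<in> type_placements L" if zs: "zs \<in> type_placements L" and inj: "inj \<sigma>" "inj \<tau>" for zs \<sigma> \<tau>
  proof -
    have "mset (map snd (g \<sigma> \<tau> zs)) = L"
      using zs by (simp add: g_def type_placements_def multiset.map_comp comp_def)
    moreover have "sorted (map fst (g \<sigma> \<tau> zs))" unfolding g_def by (rule sorted_sort_key)
    moreover have "mset (map fst (g \<sigma> \<tau> zs)) = mset (map fst (map (map_prod (map_prod \<sigma> \<tau>) id) zs))"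
      unfolding g_def mset_map mset_sort ..
    then have "distinct (map fst (g \<sigma> \<tau> zs))"
      using dist[OF _ inj] zs by (metis (no_types, lifting) mem_Collect_eq mset_eq_imp_distinct_iff strict_sorted_iff type_placements_def)
    ultimately show ?thesis by (simp add: type_placements_def strict_sorted_iff)
  qed
  \<comment> \<open>Cells are distinct, so a sorted placement is determined by its multiset and the
    intermediate sorting is harmless.\<close>
  have inv: "g \<sigma>' \<tau>' (g \<sigma> \<tau> zs) = zs"
    if zs: "zs \<in> type_placements L" and i: "\<And>x. \<sigma>' (\<sigma> x) = x" "\<And>x. \<tau>' (\<tau> x) = x" for zs \<sigma> \<tau> \<sigma>' \<tau>'
  proof (subst g_def, rule sort_key_inj_key_eq)
    have "(\<lambda>x. map_prod (map_prod \<sigma>' \<tau>') id (map_prod (map_prod \<sigma> \<tau>) id x)) = (\<lambda>x :: ((nat \<times> nat) \<times> 'c nzvec). x)"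
      using i by (auto simp: fun_eq_iff)
    then show eq: "mset (map (map_prod (map_prod \<sigma>' \<tau>') id) (g \<sigma> \<tau> zs)) = mset zs"
      by (simp add: g_def multiset.map_comp comp_def)
    have "distinct (map fst zs)" using zs by (simp add: type_placements_def strict_sorted_iff)
    moreover have "set (map (map_prod (map_prod \<sigma>' \<tau>') id) (g \<sigma> \<tau> zs)) = set zs"
      using eq by (rule mset_eq_setD)
    ultimately show "inj_on fst (set (map (map_prod (map_prod \<sigma>' \<tau>') id) (g \<sigma> \<tau> zs)))"
      by (simp only: distinct_map)
    show "sorted (map fst zs)" using zs by (simp add: type_placements_def strict_sorted_iff)
  qed
  have pp: "placed_prod (g \<sigma> \<tau> zs) = (placed_prod (map (map_prod (map_prod \<sigma> \<tau>) id) zs) :: ('c, 'k) biseries)" for \<sigma> \<tau> zs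
    by (simp add: placed_prod_def g_def)
  have sc: "scoeff (placed_prod (g \<sigma> \<tau> zs)) (move2 \<sigma> \<tau> m) = scoeff (placed_prod zs :: ('c, 'k) biseries) m" for zs
    unfolding pp by (rule scoeff_placed_prod_map[OF inj])
  have inj': "inj (inv \<sigma>)" "inj (inv \<tau>)" using assms by (simp_all add: bij_imp_bij_inv bij_is_inj)
  have 1: "g (inv \<sigma>) (inv \<tau>) (g \<sigma> \<tau> zs) = zs" if "zs \<in> type_placements L" for zs
    by (rule inv[OF that]) (simp_all add: inj)
  have 2: "g \<sigma> \<tau> (g (inv \<sigma>) (inv \<tau>) zs) = zs" if "zs \<in> type_placements L" for zs
    by (rule inv[OF that]) (simp_all add: assms bij_is_surj surj_f_inv_f)
  show ?thesis unfolding sum_scoeff_delta_M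
  proof (rule sum.reindex_bij_witness[where i = "g \<sigma> \<tau>" and j = "g (inv \<sigma>) (inv \<tau>)"])
    fix zs assume "zs \<in> {zs. zs \<in> type_placements L \<and> scoeff (placed_prod zs :: ('c, 'k) biseries) (move2 \<sigma> \<tau> m) \<noteq> 0}"
    then have zs: "zs \<in> type_placements L" "scoeff (placed_prod zs :: ('c, 'k) biseries) (move2 \<sigma> \<tau> m) \<noteq> 0" by simp_all
    show "g \<sigma> \<tau> (g (inv \<sigma>) (inv \<tau>) zs) = zs" by (rule 2[OF zs(1)])
    then show e: "scoeff (placed_prod (g (inv \<sigma>) (inv \<tau>) zs)) m = scoeff (placed_prod zs :: ('c, 'k) biseries) (move2 \<sigma> \<tau> m)"
      by (metis sc)
    show "g (inv \<sigma>) (inv \<tau>) zs \<in> {zs. zs \<in> type_placements L \<and> scoeff (placed_prod zs :: ('c, 'k) biseries) m \<noteq> 0}"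
      using tp[OF zs(1) inj'] e zs(2) by simp
  next
    fix zs assume "zs \<in> {zs. zs \<in> type_placements L \<and> scoeff (placed_prod zs :: ('c, 'k) biseries) m \<noteq> 0}"
    then have zs: "zs \<in> type_placements L" "scoeff (placed_prod zs :: ('c, 'k) biseries) m \<noteq> 0" by simp_all
    show "g (inv \<sigma>) (inv \<tau>) (g \<sigma> \<tau> zs) = zs" by (rule 1[OF zs(1)])
    show "g \<sigma> \<tau> zs \<in> {zs. zs \<in> type_placements L \<and> scoeff (placed_prod zs :: ('c, 'k) biseries) (move2 \<sigma> \<tau> m) \<noteq> 0}"
      using tp[OF zs(1) inj] zs(2) sc by simp
  qed
qed

section \<open>Expansion of the coproduct in the tensor basis\<close>

lemma move_place: "move \<sigma> (place js I) = place (map \<sigma> js) I" if "length js = length (letters I)"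
proof -
  have "image_mset h (\<Sum>l\<in>A. M l) = (\<Sum>l\<in>A. image_mset h (M l))" for h :: "nat \<times> 'a \<Rightarrow> nat \<times> 'a" and A :: "nat set" and M
    by (induction A rule: infinite_finite_induct) simp_all
  then show ?thesis using that by (simp add: move_def place_def multiset.map_comp comp_def)
qed

text \<open>A permutation matching the parts of the two compositions, applied to the positions and
  fixing all later ones, carries one leading monomial to the other.\<close>

lemma leading_same_type:
  assumes "mset (letters I) = mset (letters I')"
  obtains \<sigma> where "bij \<sigma>" "move \<sigma> (leading I) = leading I'"
proof -
  let ?n = "length (letters I')"
  obtain p where p: "p permutes {..<?n}" "permute_list p (letters I') = letters I"
    using mset_eq_permutation[OF assms] .
  have len: "length (letters I) = ?n" using assms by (rule mset_eq_length)
  have "letters I ! l = letters I' ! p l" if "l < ?n" for l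
    using p that by (metis permute_list_nth)
  then have "move p (leading I) = (\<Sum>l<?n. image_mset (Pair (p l)) (vec_of (letters I' ! p l)))"
    using len by (subst move_place) (simp_all add: place_def)
  also have "\<dots> = (\<Sum>l<?n. image_mset (Pair l) (vec_of (letters I' ! l)))"
    by (rule sum.reindex_bij_betw[OF permutes_imp_bij[OF p(1)]])
  also have "\<dots> = leading I'" by (simp add: place_def)
  finally show thesis using that permutes_bij[OF p(1)] by blast
qed

text \<open>Take the occupied positions in increasing order, and as the part at \<open>j\<close> the
  multiset of colors found there.\<close>

lemma ex_place:
  fixes m :: "(nat \<times> 'c) multiset"
  obtains js I where "length js = length (letters I)" "sorted_wrt (<) js" "m = place js I"
proof -
  define js where "js = sorted_list_of_set (fst ` set_mset m)"
  define v where "v = (\<lambda>j. image_mset snd (filter_mset (\<lambda>x. fst x = j) m))"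
  define I where "I = Word (map (\<lambda>j. Abs_nzvec (v j)) js)"
  have js: "set js = fst ` set_mset m" by (simp add: js_def)
  have v: "vec_of (Abs_nzvec (v j)) = v j" if "j \<in> set js" for j
    using that unfolding js by (intro Abs_nzvec_inverse) (auto simp: v_def filter_mset_eq_conv)
  have "place js I = (\<Sum>p\<in>#mset (zip js (map (\<lambda>j. Abs_nzvec (v j)) js)). image_mset (Pair (fst p)) (vec_of (snd p)))"
    unfolding I_def by (rule place_conv_zip) simp
  also have "\<dots> = (\<Sum>j\<in>#mset js. image_mset (Pair j) (vec_of (Abs_nzvec (v j))))"
    by (simp add: zip_map2 zip_same_conv_map image_mset.compositionality comp_def)
  also have "\<dots> = (\<Sum>j\<in>#mset js. image_mset (Pair j) (v j))"
    by (rule arg_cong[where f = sum_mset], rule image_mset_cong) (simp add: v)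
  also have "\<dots> = (\<Sum>j\<in>set js. image_mset (Pair j) (v j))"
    unfolding sum_unfold_sum_mset by (subst mset_set_set) (simp_all add: js_def)
  also have "\<dots> = (\<Sum>j\<in>set js. filter_mset (\<lambda>x. fst x = j) m)"
  proof (rule sum.cong)
    fix j
    have "image_mset (Pair j) (v j) = image_mset (\<lambda>x. x) (filter_mset (\<lambda>x. fst x = j) m)"
      unfolding v_def multiset.map_comp by (rule image_mset_cong) auto
    then show "image_mset (Pair j) (v j) = filter_mset (\<lambda>x. fst x = j) m" by simp
  qed simp
  also have "\<dots> = m"
  proof (rule multiset_eqI)
    fix x
    have "count (\<Sum>j\<in>set js. filter_mset (\<lambda>x. fst x = j) m) x = (\<Sum>j\<in>set js. if j = fst x then count m x else 0)"
      unfolding count_sum by (rule sum.cong) auto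
    also have "\<dots> = (if fst x \<in> set js then count m x else 0)" by simp
    also have "\<dots> = count m x" unfolding js by (cases "x \<in># m") (auto simp: not_in_iff)
    finally show "count (\<Sum>j\<in>set js. filter_mset (\<lambda>x. fst x = j) m) x = count m x" .
  qed
  finally have "m = place js I" ..
  moreover have "length js = length (letters I)" by (simp add: I_def)
  moreover have "sorted_wrt (<) js" by (simp add: js_def)
  ultimately show thesis using that by blast
qed

lemma place_eq_iff:
  assumes js: "length js = length (letters I)" "sorted_wrt (<) js"
    and js': "length js' = length (letters I')" "sorted_wrt (<) js'"
  shows "place js I = place js' I' \<longleftrightarrow> I = I' \<and> js = js'"
proof
  assume eq: "place js I = place js' I'"
  then have "set js = set js'" using fst_place[OF js(1)] fst_place[OF js'(1)] by simp
  then have j: "js = js'"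
    using js(2) js'(2) by (intro sorted_distinct_set_unique) (simp_all add: strict_sorted_iff)
  then show "I = I' \<and> js = js'"
    using place_inject[of js I I'] js js' eq by (simp add: strict_sorted_iff)
qed auto

lemma ex_strict_mono_extension:
  fixes js :: "nat list"
  assumes "sorted_wrt (<) js"
  obtains \<sigma> where "strict_mono \<sigma>" "map \<sigma> [0..<length js] = js"
proof -
  \<comment> \<open>Every entry of \<open>js\<close> is at most \<open>sum_list js\<close>, so the
    values after the end of the list exceed all of them.\<close>
  define \<sigma> where "\<sigma> = (\<lambda>i. if i < length js then js ! i else Suc (sum_list js) + i)"
  have "\<sigma> i < \<sigma> (Suc i)" for i
  proof -
    have "js ! i \<le> sum_list js" if "i < length js" using that by (simp add: elem_le_sum_list)
    then show ?thesis using assms sorted_wrt_nth_less[OF assms, of i "Suc i"] by (auto simp: \<sigma>_def)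
  qed
  then have "strict_mono \<sigma>" by (simp add: strict_mono_Suc_iff)
  moreover have "map \<sigma> [0..<length js] = js" by (rule nth_equalityI) (simp_all add: \<sigma>_def)
  ultimately show thesis by (rule that)
qed

text \<open>Each factor involves only its own alphabet, so the monomial splits in one way; and a
  monomial determines its composition and increasing positions.\<close>

lemma scoeff_M_tensor_place:
  assumes X: "length js = length (letters I)" "sorted_wrt (<) js"
    and Y: "length js' = length (letters J)" "sorted_wrt (<) js'"
  shows "scoeff (M_tensor I' J' :: ('c, 'k::field_char_0) biseries) (place js I, place js' J) =
    (if I' = I \<and> J' = J then 1 else 0)"
proof -
  let ?m = "(place js I, place js' J)"
  let ?X = "scoeff (M_eval (<) varX I' :: ('c, 'k) biseries)" and ?Y = "scoeff (M_eval (<) varY J' :: ('c, 'k) biseries)"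
  have set_eq: "{ks. (length ks = length (letters I') \<and> sorted_wrt (<) ks) \<and> place js I = place ks I'} = (if I' = I then {js} else {})"
    if "length js = length (letters I)" "sorted_wrt (<) js" for js I and I' :: "'c vcomp"
    using that place_eq_iff[OF that] by auto
  have "?X (place js I, {#}) = (\<Sum>ks | (length ks = length (letters I') \<and> sorted_wrt (<) ks) \<and> place js I = place ks I'. 1)"
    unfolding M_eval_var fsum_def smonom_def fseries.sel by (rule sum.cong) auto
  then have 1: "?X (place js I, {#}) = (if I' = I then 1 else 0)" unfolding set_eq[OF X] by simp
  have "?Y ({#}, place js' J) = (\<Sum>ks | (length ks = length (letters J') \<and> sorted_wrt (<) ks) \<and> place js' J = place ks J'. 1)"
    unfolding M_eval_var fsum_def smonom_def fseries.sel by (rule sum.cong) auto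
  then have 2: "?Y ({#}, place js' J) = (if J' = J then 1 else 0)" unfolding set_eq[OF Y] by simp
  have "scoeff (M_tensor I' J' :: ('c, 'k) biseries) ?m = (\<Sum>(a, b)\<in>{(a, b). a + b = ?m}. ?X a * ?Y b)"
    by (simp add: M_tensor_def times_fseries_def)
  also have "\<dots> = (\<Sum>(a, b)\<in>{((place js I, {#}), ({#}, place js' J))}. ?X a * ?Y b)"
  proof (rule sum.mono_neutral_right)
    show "\<forall>p\<in>{(a, b). a + b = ?m} - {((place js I, {#}), ({#}, place js' J))}. (case p of (a, b) \<Rightarrow> ?X a * ?Y b) = 0"
    proof (intro ballI, rule ccontr)
      fix p assume p: "p \<in> {(a, b). a + b = ?m} - {((place js I, {#}), ({#}, place js' J))}"
        and ne: "(case p of (a, b) \<Rightarrow> ?X a * ?Y b) \<noteq> 0"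
      obtain a b c d where abcd: "p = ((a, b), (c, d))" by (metis prod.exhaust)
      have "b = {#}" "c = {#}"
        using ne scoeff_M_eval_eq_0(1)[of "(a, b)" I', where 'k = 'k]
          scoeff_M_eval_eq_0(2)[of "(c, d)" J', where 'k = 'k] by (auto simp: abcd)
      with p show False by (auto simp: abcd)
    qed
  qed (simp_all add: finite_decomp)
  finally show ?thesis by (simp add: 1 2)
qed

lemma image_snd_place:
  "length js = length (letters I) \<Longrightarrow> image_mset snd (place js I) = (\<Sum>n\<in>#mset (letters I). vec_of n)"
proof -
  assume len: "length js = length (letters I)"
  have "image_mset h (\<Sum>p\<in>#A. M p) = (\<Sum>p\<in>#A. image_mset h (M p))" for h :: "nat \<times> 'a \<Rightarrow> 'a" and A :: "(nat \<times> 'a nzvec) multiset" and M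
    by (induction A) simp_all
  then have "image_mset snd (place js (Word (letters I))) = (\<Sum>p\<in>#mset (zip js (letters I)). vec_of (snd p))"
    unfolding place_conv_zip[OF len] by (simp add: multiset.map_comp comp_def)
  also have "\<dots> = (\<Sum>n\<in>#mset (map snd (zip js (letters I))). vec_of n)"
    by (simp only: mset_map multiset.map_comp comp_def)
  finally show ?thesis using len by simp
qed

text \<open>The bounds leave finitely many multidegrees, each with finitely many types, each with
  finitely many orderings of its parts.\<close>

lemma finite_bounded_leading:
  assumes "finite T"
  shows "finite {I. snd ` set_mset (leading I) \<subseteq> T \<and> size (leading I) \<le> s}"
proof -
  define D where "D = mset ` {xs. set xs \<subseteq> T \<and> length xs \<le> s}"
  have "finite D" unfolding D_def using assms by (intro finite_imageI finite_lists_length_le)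
  have "{I. snd ` set_mset (leading I) \<subseteq> T \<and> size (leading I) \<le> s} \<subseteq>
     (\<Union>d\<in>D. \<Union>L\<in>degree_types d. {I. mset (letters I) = L})"
  proof
    fix I assume I: "I \<in> {I. snd ` set_mset (leading I) \<subseteq> T \<and> size (leading I) \<le> s}"
    obtain xs where xs: "mset xs = image_mset snd (leading I)" using ex_mset by blast
    have "set xs = snd ` set_mset (leading I)" by (metis set_image_mset set_mset_mset xs)
    moreover have "length xs = size (leading I)" by (metis size_image_mset size_mset xs)
    ultimately have "image_mset snd (leading I) \<in> D"
      unfolding D_def xs[symmetric] using I by (intro imageI) simp
    moreover have "mset (letters I) \<in> degree_types (image_mset snd (leading I))"
      by (simp add: degree_types_def image_snd_place)
    ultimately show "I \<in> (\<Union>d\<in>D. \<Union>L\<in>degree_types d. {I. mset (letters I) = L})" by blast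
  qed
  then show ?thesis
    by (rule finite_subset) (use \<open>finite D\<close> finite_degree_types finite_words_mset in \<open>intro finite_UN_I; simp\<close>)
qed

text \<open>The colors in contributing monomials are summands of colors of \<open>K\<close>; the
  finite decomposition property of the color semigroup leaves only finitely many.\<close>

lemma finite_leading_delta_M:
  "finite {(I, J). scoeff (delta_M K :: ('c::{ab_semigroup_add, finite_decomp}, 'k::field_char_0) biseries) (leading I, leading J) \<noteq> 0}"
proof -
  define C where "C = (\<Union>n\<in>set (letters K). set_mset (vec_of n))"
  define T where "T = (\<Union>c\<in>C. fst ` {(a, b). a + b = c} \<union> snd ` {(a, b). a + b = c})"
  define s where "s = (\<Sum>n\<in>#mset (letters K). size (vec_of n))"
  have "finite T" unfolding T_def C_def using finite_decomp by (intro finite_UN_I finite_UnI finite_imageI) auto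
  let ?S = "{I. snd ` set_mset (leading I) \<subseteq> T \<and> size (leading I) \<le> s}"
  have "{(I, J). scoeff (delta_M K :: ('c, 'k) biseries) (leading I, leading J) \<noteq> 0} \<subseteq> ?S \<times> ?S"
  proof clarify
    fix I J assume "scoeff (delta_M K :: ('c, 'k) biseries) (leading I, leading J) \<noteq> 0"
    then obtain zs where "zs \<in> placements K"
      and ne: "scoeff (placed_prod zs :: ('c, 'k) biseries) (leading I, leading J) \<noteq> 0"
      unfolding scoeff_delta_M by (auto elim!: sum.not_neutral_contains_not_neutral)
    then have K: "letters K = map snd zs" by (simp add: placements_def)
    note * = scoeff_placed_prod_nonzeroD[OF ne]
    have s: "size (leading I) \<le> s" "size (leading J) \<le> s"
      unfolding *(2) unfolding *(1) by (simp_all add: s_def K multiset.map_comp comp_def)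
    have "snd x \<in> T" if x: "x \<in># leading I" for x
    proof -
      obtain z c b where "z \<in> set zs" "c \<in># vec_of (snd z)" "snd x + b = c" using *(4)[OF x] by blast
      then show ?thesis unfolding T_def C_def K by (force intro: image_eqI[where x = "(snd x, b)"])
    qed
    moreover have "snd x \<in> T" if x: "x \<in># leading J" for x
    proof -
      obtain z c a where "z \<in> set zs" "c \<in># vec_of (snd z)" "a + snd x = c" using *(5)[OF x] by blast
      then show ?thesis unfolding T_def C_def K by (force intro: image_eqI[where x = "(a, snd x)"])
    qed
    ultimately show "I \<in> ?S \<and> J \<in> ?S" using s by blast
  qed
  then show ?thesis
    by (rule finite_subset) (intro finite_cartesian_product finite_bounded_leading \<open>finite T\<close>)
qed

text \<open>Every monomial arises from a pair of leading monomials by increasing relabellings, so by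
  quasi-symmetry the coefficients at leading pairs determine the whole series.\<close>

lemma delta_M_expansion:
  "delta_M K = (\<Sum>(I, J) | scoeff (delta_M K :: ('c::{ab_semigroup_add, finite_decomp}, 'k::field_char_0) biseries) (leading I, leading J) \<noteq> 0.
     sscale (scoeff (delta_M K) (leading I, leading J)) (M_tensor I J :: ('c, 'k) biseries))" (is "_ = (\<Sum>(I, J)\<in>?Z. _)")
proof (rule fseries_eqI)
  fix m :: "(nat \<times> 'c) multiset \<times> (nat \<times> 'c) multiset"
  obtain js I where I: "length js = length (letters I)" "sorted_wrt (<) js" "fst m = place js I" by (rule ex_place)
  obtain ks J where J: "length ks = length (letters J)" "sorted_wrt (<) ks" "snd m = place ks J" by (rule ex_place)
  obtain \<sigma> where \<sigma>: "strict_mono \<sigma>" "map \<sigma> [0..<length js] = js" using ex_strict_mono_extension[OF I(2)] .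
  obtain \<tau> where \<tau>: "strict_mono \<tau>" "map \<tau> [0..<length ks] = ks" using ex_strict_mono_extension[OF J(2)] .
  have m: "m = (place js I, place ks J)" using I J by (simp add: prod_eq_iff)
  also have "\<dots> = move2 \<sigma> \<tau> (leading I, leading J)"
    using I J \<sigma> \<tau> by (simp add: move2_def move_place)
  finally have "scoeff (delta_M K :: ('c, 'k) biseries) m = scoeff (delta_M K) (leading I, leading J)"
    using scoeff_delta_M_quasi_symmetric[OF \<sigma>(1) \<tau>(1)] by metis
  also have "\<dots> = (\<Sum>p\<in>?Z. if p = (I, J) then scoeff (delta_M K) (leading I, leading J) else 0)"
    using finite_leading_delta_M[of K, where 'k = 'k] by simp
  also have "\<dots> = scoeff (\<Sum>(I, J)\<in>?Z. sscale (scoeff (delta_M K) (leading I, leading J)) (M_tensor I J :: ('c, 'k) biseries)) m"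
    unfolding scoeff_sum
    by (rule sum.cong) (auto simp: sscale_def m scoeff_M_tensor_place[OF I(1,2) J(1,2)] split: if_splits)
  finally show "scoeff (delta_M K :: ('c, 'k) biseries) m =
     scoeff (\<Sum>(I, J)\<in>?Z. sscale (scoeff (delta_M K) (leading I, leading J)) (M_tensor I J :: ('c, 'k) biseries)) m" .
qed

lemma independent_M_tensor:
  "biseries.independent (range (\<lambda>(I, J). M_tensor I J) :: ('c, 'k::field_char_0) biseries set)"
  unfolding biseries.dependent_explicit
proof safe
  fix t u I J assume t: "finite t" "t \<subseteq> range (\<lambda>(I, J). M_tensor I J :: ('c, 'k) biseries)" "(\<Sum>v\<in>t. sscale (u v) v) = 0"
  fix v assume v: "v \<in> t" "u v \<noteq> 0"
  then obtain I J where IJ: "v = M_tensor I J" using t by auto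
  let ?m = "(leading I, leading J)"
  have "0 = (\<Sum>w\<in>t. u w * scoeff w ?m)"
    using arg_cong[OF t(3), of "\<lambda>f. scoeff f ?m"] by (simp add: scoeff_sum sscale_def zero_fseries_def)
  also have "\<dots> = (\<Sum>w\<in>t. if w = v then u v else 0)"
  proof (rule sum.cong)
    fix w assume "w \<in> t"
    then obtain I' J' where w: "w = M_tensor I' J'" using t by auto
    show "u w * scoeff w ?m = (if w = v then u v else 0)"
      using scoeff_M_tensor_leading[of I' J' I J, where 'k = 'k]
        scoeff_M_tensor_leading[of I J I J, where 'k = 'k] by (auto simp: w IJ)
  qed simp
  also have "\<dots> = u v" using t v by simp
  finally show False using v by simp
qed

text \<open>\<open>representation\<close> gives true coordinates only for an independent set and a
  vector in its span, and 0 otherwise. Both conditions now hold, and the leading pair singles out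
  one basis element.\<close>

lemma delta_coeff_eq:
  "delta_coeff K I J = scoeff (delta_M K :: ('c::{ab_semigroup_add, finite_decomp}, 'k::field_char_0) biseries) (leading I, leading J)"
proof -
  define B where "B = (range (\<lambda>(I, J). M_tensor I J) :: ('c, 'k) biseries set)"
  define r where "r = biseries.representation B (delta_M K)"
  have ind: "biseries.independent B" unfolding B_def by (rule independent_M_tensor)
  have "delta_M K \<in> biseries.span B"
    by (subst delta_M_expansion, rule biseries.span_sum, clarify, rule biseries.span_scale, rule biseries.span_base)
      (auto simp: B_def)
  then have "scoeff (delta_M K :: ('c, 'k) biseries) (leading I, leading J) = (\<Sum>b | r b \<noteq> 0. r b * scoeff b (leading I, leading J))"
    by (subst biseries.sum_nonzero_representation_eq[OF ind, folded r_def, symmetric]) (simp_all add: scoeff_sum sscale_def r_def)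
  also have "\<dots> = (\<Sum>b | r b \<noteq> 0. if b = M_tensor I J then r b else 0)"
  proof (rule sum.cong)
    fix b assume "b \<in> {b. r b \<noteq> 0}"
    then have "b \<in> B" unfolding r_def using biseries.representation_ne_zero by blast
    then obtain I' J' where b: "b = M_tensor I' J'" by (auto simp: B_def)
    show "r b * scoeff b (leading I, leading J) = (if b = M_tensor I J then r b else 0)"
      using scoeff_M_tensor_leading[of I' J' I J, where 'k = 'k]
        scoeff_M_tensor_leading[of I J I J, where 'k = 'k] by (auto simp: b)
  qed simp
  also have "\<dots> = r (M_tensor I J)"
    using biseries.finite_representation[of B "delta_M K"] by (simp flip: r_def)
  finally show ?thesis by (simp add: delta_coeff_def r_def B_def)
qed

text \<open>The coefficients of \<open>\<delta>\<close> of a monomial symmetric function, indexed by types of vector compositions.\<close>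

definition type_delta :: "'c::{ab_semigroup_add, finite_decomp} nzvec multiset \<Rightarrow> 'c nzvec multiset \<Rightarrow> 'c nzvec multiset \<Rightarrow> 'k::field_char_0" where
  "type_delta L A B = (\<Sum>K | mset (letters K) = L. delta_coeff K (SOME I. mset (letters I) = A) (SOME J. mset (letters J) = B))"

text \<open>The representatives chosen in \<open>type_delta\<close> can be exchanged for
  \<open>I\<close> and \<open>J\<close>: permutations of rows and columns match the leading
  monomials, and the sum over \<open>K\<close> is invariant under them.\<close>

lemma sum_delta_coeff:
  "(\<Sum>K | mset (letters K) = L. delta_coeff K I J) =
    (type_delta L (mset (letters I)) (mset (letters J)) :: 'k::field_char_0)"
proof -
  let ?I = "SOME I'. mset (letters I') = mset (letters I)" and ?J = "SOME J'. mset (letters J') = mset (letters J)"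
  have "mset (letters ?I) = mset (letters I)" "mset (letters ?J) = mset (letters J)"
    by (rule someI, rule refl)+
  then obtain \<sigma> \<tau> where "bij \<sigma>" "move \<sigma> (leading ?I) = leading I" "bij \<tau>" "move \<tau> (leading ?J) = leading J"
    by (meson leading_same_type)
  then show ?thesis
    using sum_scoeff_delta_M_symmetric[of \<sigma> \<tau> "(leading ?I, leading ?J)" L, where 'k = 'k]
    by (simp add: type_delta_def delta_coeff_eq move2_def)
qed

section \<open>Descent of the internal product to commutative images\<close>

lemma sum_lookup_type:
  fixes F :: "('c, 'k::field_char_0) ncsym"
  assumes "finite A" "(\<lambda>I. mset (letters I)) ` Poly_Mapping.keys F \<subseteq> A"
  shows "(\<Sum>I\<in>Poly_Mapping.keys F. Poly_Mapping.lookup F I * h (mset (letters I))) = (\<Sum>L\<in>A. type_coeff F L * h L)"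
proof -
  let ?X = "SIGMA L:A. {I. mset (letters I) = L}"
  have "(\<Sum>L\<in>A. type_coeff F L * h L) = (\<Sum>(L, I)\<in>?X. Poly_Mapping.lookup F I * h L)"
    unfolding type_coeff_def sum_distrib_right
    using assms(1) by (intro sum.Sigma) (simp_all add: finite_words_mset)
  also have "\<dots> = (\<Sum>I\<in>snd ` ?X. Poly_Mapping.lookup F I * h (mset (letters I)))"
    by (rule sum.reindex_cong[where l = "\<lambda>I. (mset (letters I), I)"]) (force simp: inj_on_def image_iff)+
  also have "\<dots> = (\<Sum>I\<in>Poly_Mapping.keys F. Poly_Mapping.lookup F I * h (mset (letters I)))"
  proof (rule sum.mono_neutral_right)
    have "finite ?X" using assms(1) finite_words_mset by (intro finite_SigmaI) auto
    then show "finite (snd ` ?X)" by simp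
    show "Poly_Mapping.keys F \<subseteq> snd ` ?X" using assms(2) by force
  qed (auto simp: in_keys_iff)
  finally show ?thesis by simp
qed

text \<open>The right-hand side sees \<open>F\<close> and \<open>G\<close> only through their type
  coefficients. The index sets are left free so that different elements can be compared over the
  same ones.\<close>

lemma type_coeff_internal_prod:
  fixes F G :: "('c::{ab_semigroup_add, finite_decomp}, 'k::field_char_0) ncsym"
  assumes "finite A" "(\<lambda>I. mset (letters I)) ` Poly_Mapping.keys F \<subseteq> A"
    and "finite B" "(\<lambda>J. mset (letters J)) ` Poly_Mapping.keys G \<subseteq> B"
  shows "type_coeff (F \<star> G) L = (\<Sum>M\<in>A. type_coeff F M * (\<Sum>N\<in>B. type_coeff G N * type_delta L M N))"
proof -
  let ?F = "Poly_Mapping.lookup F" and ?G = "Poly_Mapping.lookup G"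
  let ?K = "{K. mset (letters K) = L}"
  have "type_coeff (F \<star> G) L = (\<Sum>K\<in>?K. \<Sum>I\<in>Poly_Mapping.keys F. \<Sum>J\<in>Poly_Mapping.keys G. ?F I * ?G J * delta_coeff K I J)"
    by (simp add: type_coeff_def internal_prod.rep_eq keys.rep_eq)
  also have "\<dots> = (\<Sum>I\<in>Poly_Mapping.keys F. \<Sum>J\<in>Poly_Mapping.keys G. \<Sum>K\<in>?K. ?F I * ?G J * delta_coeff K I J)"
    by (subst sum.swap, rule sum.cong[OF refl], rule sum.swap)
  also have "\<dots> = (\<Sum>I\<in>Poly_Mapping.keys F. ?F I * (\<Sum>J\<in>Poly_Mapping.keys G. ?G J * type_delta L (mset (letters I)) (mset (letters J))))"
    by (simp only: sum_distrib_left mult.assoc flip: sum_delta_coeff)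
  also have "\<dots> = (\<Sum>M\<in>A. type_coeff F M * (\<Sum>N\<in>B. type_coeff G N * type_delta L M N))"
    unfolding sum_lookup_type[OF assms(3,4), where h = "type_delta L _"]
    by (rule sum_lookup_type[OF assms(1,2), where h = "\<lambda>M. \<Sum>N\<in>B. type_coeff G N * type_delta L M N"])
  finally show ?thesis .
qed

lemma comm_image_internal_prod_cong:
  fixes F F' G G' :: "('c::{ab_semigroup_add, finite_decomp}, 'k::field_char_0) ncsym"
  assumes "comm_image F = comm_image F'" "comm_image G = comm_image G'"
  shows "comm_image (F \<star> G) = comm_image (F' \<star> G')"
proof -
  let ?t = "\<lambda>H :: ('c, 'k) ncsym. (\<lambda>I. mset (letters I)) ` Poly_Mapping.keys H"
  have "type_coeff (F \<star> G) L = type_coeff (F' \<star> G') L" for L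
    \<comment> \<open>Over the unions of the occurring types both sides have the same
      expansion.\<close>
    using assms type_coeff_internal_prod[of "?t F \<union> ?t F'" F "?t G \<union> ?t G'" G L]
      type_coeff_internal_prod[of "?t F \<union> ?t F'" F' "?t G \<union> ?t G'" G' L]
    by (simp add: comm_image_eq_iff)
  then show ?thesis by (simp add: comm_image_eq_iff fun_eq_iff)
qed

lemma lookup_scale: "Poly_Mapping.lookup (Poly_Mapping.map ((*) a) F) I = a * Poly_Mapping.lookup F I"
  for a :: "'k::mult_zero"
  by (simp add: map.rep_eq when_def)

lemma comm_image_scale_add:
  "comm_image (Poly_Mapping.map ((*) a) F + F') = sscale a (comm_image F) + comm_image F'"
proof -
  let ?A = "Poly_Mapping.keys F \<union> Poly_Mapping.keys F'"
  have "Poly_Mapping.keys (Poly_Mapping.map ((*) a) F + F') \<subseteq> ?A"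
    by (auto simp: in_keys_iff lookup_add lookup_scale)
  then have "comm_image (Poly_Mapping.map ((*) a) F + F') =
      (\<Sum>I\<in>?A. sscale (a * Poly_Mapping.lookup F I + Poly_Mapping.lookup F' I) (hprod (mset (letters I))))"
    by (subst comm_image_eq[of ?A]) (simp_all add: lookup_add lookup_scale)
  also have "\<dots> = sscale a (comm_image F) + comm_image F'"
    by (simp add: comm_image_eq[of ?A] fser.scale_left_distrib sum.distrib fser.scale_sum_right)
  finally show ?thesis .
qed

text \<open>Linearity is checked on type coefficients, where the sums run over fixed index sets
  instead of supports that change with the arguments.\<close>

lemma comm_image_internal_prod_linear:
  fixes F F' G :: "('c::{ab_semigroup_add, finite_decomp}, 'k::field_char_0) ncsym"
  shows "comm_image ((Poly_Mapping.map ((*) a) F + F') \<star> G) = sscale a (comm_image (F \<star> G)) + comm_image (F' \<star> G)"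
    and "comm_image (G \<star> (Poly_Mapping.map ((*) a) F + F')) = sscale a (comm_image (G \<star> F)) + comm_image (G \<star> F')"
proof -
  let ?t = "\<lambda>H :: ('c, 'k) ncsym. (\<lambda>I. mset (letters I)) ` Poly_Mapping.keys H"
  let ?H = "Poly_Mapping.map ((*) a) F + F'"
  have lin: "type_coeff (Poly_Mapping.map ((*) a) H + H') L = a * type_coeff H L + type_coeff H' L"
    for H H' :: "('c, 'k) ncsym" and L
    by (simp add: type_coeff_def lookup_add lookup_scale sum.distrib sum_distrib_left)
  have "Poly_Mapping.keys ?H \<subseteq> Poly_Mapping.keys F \<union> Poly_Mapping.keys F'"
    by (auto simp: in_keys_iff lookup_add lookup_scale)
  then have k: "?t ?H \<subseteq> ?t F \<union> ?t F'" by blast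
  have "type_coeff (?H \<star> G) = type_coeff (Poly_Mapping.map ((*) a) (F \<star> G) + F' \<star> G)"
    using k unfolding lin fun_eq_iff
    by (simp add: type_coeff_internal_prod[of "?t F \<union> ?t F'" _ "?t G"] lin sum.distrib sum_distrib_left distrib_left distrib_right mult_ac)
  then show "comm_image (?H \<star> G) = sscale a (comm_image (F \<star> G)) + comm_image (F' \<star> G)"
    unfolding comm_image_eq_iff[symmetric] comm_image_scale_add .
  have "type_coeff (G \<star> ?H) = type_coeff (Poly_Mapping.map ((*) a) (G \<star> F) + G \<star> F')"
    using k unfolding lin fun_eq_iff
    by (simp add: type_coeff_internal_prod[of "?t G" _ "?t F \<union> ?t F'"] lin sum.distrib sum_distrib_left distrib_left distrib_right mult_ac)
  then show "comm_image (G \<star> ?H) = sscale a (comm_image (G \<star> F)) + comm_image (G \<star> F')"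
    unfolding comm_image_eq_iff[symmetric] comm_image_scale_add .
qed

theorem mainTheorem7:
  shows "(\<exists>P :: ((nat \<times> 'c::{ab_semigroup_add, finite_decomp}) multiset, 'k::field_char_0) fseries
            \<Rightarrow> ((nat \<times> 'c) multiset, 'k) fseries \<Rightarrow> ((nat \<times> 'c) multiset, 'k) fseries.
          (\<forall>f\<in>MSym. \<forall>g\<in>MSym. P f g \<in> MSym) \<and>
          (\<forall>f\<in>MSym. \<forall>f'\<in>MSym. \<forall>g\<in>MSym. \<forall>a.
             P (sscale a f + f') g = sscale a (P f g) + P f' g \<and>
             P g (sscale a f + f') = sscale a (P g f) + P g f') \<and>
          (\<forall>F G. P (comm_image F) (comm_image G) = comm_image (F \<star> G))) \<and>
         (\<forall>F F' G G' :: ('c, 'k) ncsym.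
            comm_image F = comm_image F' \<longrightarrow> comm_image G = comm_image G' \<longrightarrow>
            comm_image (F \<star> G) = comm_image (F' \<star> G'))"
proof (intro conjI exI)
  \<comment> \<open>An arbitrary preimage under the commutative image map; the congruence makes the
    choice immaterial on \<open>MSym\<close>.\<close>
  let ?lift = "\<lambda>f. SOME F :: ('c, 'k) ncsym. comm_image F = f"
  let ?P = "\<lambda>f g. comm_image (?lift f \<star> ?lift g)"
  have lift: "comm_image (?lift (comm_image F)) = comm_image F" for F :: "('c, 'k) ncsym"
    by (rule someI) (rule refl)
  have P: "?P (comm_image F) (comm_image G) = comm_image (F \<star> G)" for F G :: "('c, 'k) ncsym"
    by (rule comm_image_internal_prod_cong[OF lift lift])
  then show "\<forall>F G. ?P (comm_image F) (comm_image G) = comm_image (F \<star> G)" by blast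
  show "\<forall>f\<in>MSym. \<forall>g\<in>MSym. ?P f g \<in> MSym" by (simp add: MSym_def)
  show "\<forall>f\<in>MSym. \<forall>f'\<in>MSym. \<forall>g\<in>MSym. \<forall>a.
             ?P (sscale a f + f') g = sscale a (?P f g) + ?P f' g \<and>
             ?P g (sscale a f + f') = sscale a (?P g f) + ?P g f'"
  proof (intro ballI allI)
    fix f f' g :: "((nat \<times> 'c) multiset, 'k) fseries" and a
    assume "f \<in> MSym" "f' \<in> MSym" "g \<in> MSym"
    then obtain F F' G where FG: "f = comm_image F" "f' = comm_image F'" "g = comm_image G"
      by (auto simp: MSym_def)
    show "?P (sscale a f + f') g = sscale a (?P f g) + ?P f' g \<and>
        ?P g (sscale a f + f') = sscale a (?P g f) + ?P g f'"
      unfolding FG comm_image_scale_add[symmetric] P comm_image_internal_prod_linear by simp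
  qed
qed (use comm_image_internal_prod_cong in blast)

end
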